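(* Let $n\ge 6$. There is a hypersurface $X$ in the Grassmannian $Gr(3,n)$, each component of which is the intersection of $Gr(3,n)\subset\mathbb{P}(\bigwedge^3\mathbb{C}^n)$ with a quadric, such that the set of generic arrangements $\mathcal{A}$ of $n$ hyperplanes in $\mathbb{C}^3$ that contain a dependent sub-arrangement, viewed as points of $Gr(3,n)$, is the set of points of $X$ (among the points of $Gr(3,n)$ that correspond to generic arrangements).
   Context: An arrangement $\mathcal{A}=\{H_1^0,\dots,H_n^0\}$ of hyperplanes through the origin in $\mathbb{C}^3$ is generic if any three of the $H_i^0$ intersect only in $0$; equivalently, if $\alpha_i=(a_{i1},a_{i2},a_{i3})$ is a normal vector to $H_i^0$ (with respect to the bilinear dot product $\sum_j a_jv_j$), any three of the $\alpha_i$ are linearly independent. A generic arrangement is viewed as a point of $Gr(3,n)$, the Grassmannian of $3$-dimensional subspaces of $\mathbb{C}^n$, as follows: the $n\times 3$ matrix $(a_{ij})$ with rows $\alpha_1,\dots,\alpha_n$ has linearly independent columns, and the point is the $3$-dimensional subspace of $\mathbb{C}^n$ spanned by these columns. Its Plücker coordinates are the $3\times 3$ minors $\beta_{ijk}=\det(\alpha_i,\alpha_j,\alpha_k)$. Rescaling the normal vectors moves the point by the action of the diagonal torus $(\mathbb{C}^* )^n$; all points obtained from the choices of normal vectors are regarded as corresponding to $\mathcal{A}$. The points of $Gr(3,n)$ corresponding to generic arrangements are exactly those for which all Plücker coordinates are nonzero (equivalently, the subspaces meeting every coordinate subspace of $\mathbb{C}^n$ transversally). $Gr(3,n)$ is regarded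 as a projective variety via the Plücker embedding into $\mathbb{P}(\bigwedge^3\mathbb{C}^n)$. The trace at infinity $\mathcal{A}_\infty$ of $\mathcal{A}$ is the arrangement of lines $H_{\infty,i}=\bar H_i^0\cap H_\infty$ in the plane at infinity $H_\infty\cong\mathbb{P}^2$ of $\mathbb{P}^3\supset\mathbb{C}^3$, where $\bar H_i^0$ is the projective closure. A sub-arrangement of $\mathcal{A}$ consisting of six hyperplanes is dependent if its six lines at infinity are dependent: there is a partition of the six indices into three sets $I_1,I_2,I_3$ of two elements each such that the three points $P_j=\bigcap_{t\in I_j}H_{\infty,t}$, $j=1,2,3$, span a proper subspace of $H_\infty\cong\mathbb{P}^2$ (i.e. are collinear). *)

theory Defs
  imports "HOL-Analysis.Analysis"
begin

subsection \<open>Projective space over the complex numbers\<close>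

text \<open>A homogeneous polynomial function of degree \<open>d\<close>; a monomial is given by its exponent
  vector \<open>m\<close>.\<close>

definition form :: "nat \<Rightarrow> (complex^'m \<Rightarrow> complex) \<Rightarrow> bool" where
  "form d F \<longleftrightarrow>
     (\<exists>c :: ('m \<Rightarrow> nat) \<Rightarrow> complex.
        \<forall>x. F x = (\<Sum>m\<in>{m. (\<Sum>i\<in>UNIV. m i) = d}. c m * (\<Prod>i\<in>UNIV. x $ i ^ m i)))"

lemma finite_exponents: "finite {m :: 'm::finite \<Rightarrow> nat. (\<Sum>i\<in>UNIV. m i) = d}"
proof (rule finite_subset)
  show "{m :: 'm \<Rightarrow> nat. (\<Sum>i\<in>UNIV. m i) = d} \<subseteq> PiE UNIV (\<lambda>_. {..d})"
    by (auto simp: PiE_UNIV_domain intro: member_le_sum)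
  show "finite (PiE (UNIV :: 'm set) (\<lambda>_. {..d}))"
    by (intro finite_PiE) auto
qed

lemma form_one: "form 0 (\<lambda>x :: complex^'m. 1)"
proof -
  have "{m :: 'm \<Rightarrow> nat. (\<Sum>i\<in>UNIV. m i) = 0} = {\<lambda>_. 0}"
    by auto
  then show ?thesis
    unfolding form_def by (intro exI[of _ "\<lambda>_. 1"]) simp
qed

lemma form_mult:
  fixes F G :: "complex^'m \<Rightarrow> complex"
  assumes "form d F" "form e G"
  shows "form (d + e) (\<lambda>x. F x * G x)"
proof -
  define E where "E = (\<lambda>d. {m :: 'm \<Rightarrow> nat. (\<Sum>i\<in>UNIV. m i) = d})"
  have fin: "finite (E k)" for k
    unfolding E_def by (rule finite_exponents)
  define mon where "mon = (\<lambda>(m :: 'm \<Rightarrow> nat) (x :: complex^'m). \<Prod>i\<in>UNIV. x $ i ^ m i)"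
  define add where "add = (\<lambda>p :: ('m \<Rightarrow> nat) \<times> ('m \<Rightarrow> nat). \<lambda>i. fst p i + snd p i)"
  obtain a where a: "\<And>x. F x = (\<Sum>m\<in>E d. a m * mon m x)"
    using assms(1) unfolding form_def E_def mon_def by blast
  obtain b where b: "\<And>x. G x = (\<Sum>m\<in>E e. b m * mon m x)"
    using assms(2) unfolding form_def E_def mon_def by blast
  define c where "c = (\<lambda>k. \<Sum>p\<in>{p \<in> E d \<times> E e. add p = k}. a (fst p) * b (snd p))"
  have mon_add: "mon (add p) x = mon (fst p) x * mon (snd p) x" for p x
    by (simp add: mon_def add_def power_add prod.distrib)
  have sub: "add ` (E d \<times> E e) \<subseteq> E (d + e)"
    by (auto simp: add_def E_def sum.distrib)
  have "F x * G x = (\<Sum>k\<in>E (d + e). c k * mon k x)" for x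
  proof -
    have "F x * G x = (\<Sum>p\<in>E d \<times> E e. a (fst p) * b (snd p) * mon (add p) x)"
      by (simp add: a b sum_product sum.cartesian_product mon_add case_prod_beta mult_ac)
    also have "\<dots> = (\<Sum>k\<in>E (d + e). \<Sum>p\<in>{p \<in> E d \<times> E e. add p = k}.
                       a (fst p) * b (snd p) * mon (add p) x)"
      by (rule sum.group[symmetric]) (use fin sub in auto)
    also have "\<dots> = (\<Sum>k\<in>E (d + e). c k * mon k x)"
      by (simp add: c_def sum_distrib_right)
    finally show ?thesis .
  qed
  then show ?thesis
    unfolding form_def E_def mon_def by blast
qed

text \<open>The projective space \<open>\<P>(V)\<close> of a linear subspace \<open>V\<close>: its points are the lines in \<open>V\<close>.\<close>

definition proj_space :: "(complex^'m) set \<Rightarrow> (complex^'m) set set" where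
  "proj_space V = {L. vec.subspace L \<and> vec.dim L = 1 \<and> L \<subseteq> V}"

definition proj_zeros :: "(complex^'m) set \<Rightarrow> (complex^'m \<Rightarrow> complex) set \<Rightarrow> (complex^'m) set set" where
  "proj_zeros V S = {L \<in> proj_space V. \<forall>F\<in>S. \<forall>x\<in>L. F x = 0}"

definition zariski :: "(complex^'m) set \<Rightarrow> (complex^'m) set topology" where
  "zariski V = topology (\<lambda>U. \<exists>S. (\<forall>F\<in>S. \<exists>d. form d F) \<and> U = proj_space V - proj_zeros V S)"

lemma proj_obtains:
  assumes "L \<in> proj_space V"
  obtains v where "v \<in> L" "\<And>x. x \<in> L \<Longrightarrow> \<exists>c. x = c *s v"
proof -
  obtain B where B: "B \<subseteq> L" "L \<subseteq> vec.span B" "card B = vec.dim L"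
    using vec.basis_exists by metis
  then obtain v where "B = {v}"
    using assms by (auto simp: proj_space_def card_1_singleton_iff)
  then show ?thesis
    using B that[of v] by (auto simp: vec.span_singleton)
qed

lemma form_scale:
  assumes "form d F"
  shows "F (c *s x) = c ^ d * F x"
proof -
  obtain a where a: "\<And>x. F x = (\<Sum>m\<in>{m. (\<Sum>i\<in>UNIV. m i) = d}. a m * (\<Prod>i\<in>UNIV. x $ i ^ m i))"
    using assms unfolding form_def by blast
  show ?thesis
    unfolding a sum_distrib_left
    by (rule sum.cong) (auto simp: power_mult_distrib prod.distrib power_sum[symmetric])
qed

lemma istopology_zariski:
  "istopology (\<lambda>U. \<exists>S. (\<forall>F\<in>S. \<exists>d. form d F) \<and> U = proj_space V - proj_zeros V S)"
  unfolding istopology_def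
proof (intro conjI allI impI)
  fix A B
  assume "\<exists>S. (\<forall>F\<in>S. \<exists>d. form d F) \<and> A = proj_space V - proj_zeros V S"
     and "\<exists>S. (\<forall>F\<in>S. \<exists>d. form d F) \<and> B = proj_space V - proj_zeros V S"
  then obtain S T where S: "\<forall>F\<in>S. \<exists>d. form d F" "A = proj_space V - proj_zeros V S"
    and T: "\<forall>F\<in>T. \<exists>d. form d F" "B = proj_space V - proj_zeros V T" by blast
  define R where "R = {\<lambda>x. F x * G x | F G. F \<in> S \<and> G \<in> T}"
  have R: "\<forall>F\<in>R. \<exists>d. form d F"
    using S(1) T(1) form_mult unfolding R_def by fastforce
  have "L \<in> proj_zeros V R \<longleftrightarrow> L \<in> proj_zeros V S \<or> L \<in> proj_zeros V T" if L: "L \<in> proj_space V" for L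
  proof
    assume LR: "L \<in> proj_zeros V R"
    show "L \<in> proj_zeros V S \<or> L \<in> proj_zeros V T"
    proof (rule ccontr)
      assume "\<not> ?thesis"
      then obtain F G x y where FG: "F \<in> S" "G \<in> T" "x \<in> L" "y \<in> L" "F x \<noteq> 0" "G y \<noteq> 0"
        using L by (auto simp: proj_zeros_def)
      obtain v where v: "v \<in> L" "\<And>x. x \<in> L \<Longrightarrow> \<exists>c. x = c *s v"
        using proj_obtains[OF L] by metis
      obtain d e where "form d F" "form e G"
        using FG S(1) T(1) by blast
      then have "F v \<noteq> 0" "G v \<noteq> 0"
        using v(2)[OF FG(3)] v(2)[OF FG(4)] FG(5,6) by (auto simp: form_scale)
      moreover have "(\<lambda>x. F x * G x) \<in> R"
        using FG(1,2) unfolding R_def by blast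
      then have "F v * G v = 0"
        using LR v(1) unfolding proj_zeros_def by fastforce
      ultimately show False by simp
    qed
  next
    assume "L \<in> proj_zeros V S \<or> L \<in> proj_zeros V T"
    then show "L \<in> proj_zeros V R"
      unfolding proj_zeros_def R_def by auto
  qed
  then have "A \<inter> B = proj_space V - proj_zeros V R"
    unfolding S T by (auto simp: proj_zeros_def)
  then show "\<exists>S. (\<forall>F\<in>S. \<exists>d. form d F) \<and> A \<inter> B = proj_space V - proj_zeros V S"
    using R by blast
next
  fix K
  assume K: "\<forall>U\<in>K. \<exists>S. (\<forall>F\<in>S. \<exists>d. form d F) \<and> U = proj_space V - proj_zeros V S"
  then obtain s where s: "\<And>U. U \<in> K \<Longrightarrow> (\<forall>F\<in>s U. \<exists>d. form d F) \<and> U = proj_space V - proj_zeros V (s U)"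
    by metis
  have "\<Union>K = (\<Union>U\<in>K. proj_space V - proj_zeros V (s U))"
    using s by blast
  also have "\<dots> = proj_space V - proj_zeros V (\<Union>(s ` K))"
    by (auto simp: proj_zeros_def)
  finally show "\<exists>S. (\<forall>F\<in>S. \<exists>d. form d F) \<and> \<Union>K = proj_space V - proj_zeros V S"
    using s by (intro exI[of _ "\<Union>(s ` K)"]) auto
qed

lemma openin_zariski:
  "openin (zariski V) U \<longleftrightarrow> (\<exists>S. (\<forall>F\<in>S. \<exists>d. form d F) \<and> U = proj_space V - proj_zeros V S)"
  unfolding zariski_def using istopology_zariski[of V] by (simp add: topology_inverse')

lemma topspace_zariski: "topspace (zariski V) = proj_space V"
proof
  show "topspace (zariski V) \<subseteq> proj_space V"
    using openin_topspace[of "zariski V"] unfolding openin_zariski by blast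
  have "proj_zeros V {\<lambda>x. 1} = {}"
    using vec.subspace_0 by (auto simp: proj_zeros_def proj_space_def)
  then have "openin (zariski V) (proj_space V)"
    unfolding openin_zariski using form_one by (intro exI[of _ "{\<lambda>x. 1}"]) auto
  then show "proj_space V \<subseteq> topspace (zariski V)"
    by (rule openin_subset)
qed

lemma closedin_zariski:
  "closedin (zariski V) C \<longleftrightarrow> (\<exists>S. (\<forall>F\<in>S. \<exists>d. form d F) \<and> C = proj_zeros V S)"
proof -
  have "proj_zeros V S \<subseteq> proj_space V" for S
    by (auto simp: proj_zeros_def)
  then have *: "C \<subseteq> proj_space V \<and> proj_space V - C = proj_space V - proj_zeros V S \<longleftrightarrow> C = proj_zeros V S" for S
    by (metis Diff_Diff_Int inf.absorb_iff2)
  show ?thesis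
    unfolding closedin_def topspace_zariski openin_zariski using * by metis
qed

definition quadric :: "(complex^'m) set \<Rightarrow> (complex^'m) set set \<Rightarrow> bool" where
  "quadric V Q \<longleftrightarrow> (\<exists>q. form 2 q \<and> (\<exists>x\<in>V. q x \<noteq> 0) \<and> Q = proj_zeros V {q})"


subsection \<open>Irreducible components, codimension, hypersurfaces\<close>

definition irreducible_in :: "'a topology \<Rightarrow> 'a set \<Rightarrow> bool" where
  "irreducible_in T Z \<longleftrightarrow> Z \<subseteq> topspace T \<and> Z \<noteq> {} \<and>
     (\<forall>C D. closedin T C \<and> closedin T D \<and> Z \<subseteq> C \<union> D \<longrightarrow> Z \<subseteq> C \<or> Z \<subseteq> D)"

definition irreducible_component :: "'a topology \<Rightarrow> 'a set \<Rightarrow> 'a set \<Rightarrow> bool" where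
  "irreducible_component T X Z \<longleftrightarrow> Z \<subseteq> X \<and> irreducible_in T Z \<and>
     (\<forall>Y. irreducible_in T Y \<and> Z \<subseteq> Y \<and> Y \<subseteq> X \<longrightarrow> Y = Z)"

text \<open>The supremum of the lengths \<open>k\<close> of chains \<open>Z = C\<^sub>0 \<subset> C\<^sub>1 \<subset> \<dots> \<subset> C\<^sub>k\<close> of irreducible closed sets.\<close>

definition codimension :: "'a topology \<Rightarrow> 'a set \<Rightarrow> enat" where
  "codimension T Z = Sup {enat k | k. \<exists>C :: nat \<Rightarrow> 'a set. C 0 = Z \<and>
     (\<forall>i\<le>k. closedin T (C i) \<and> irreducible_in T (C i)) \<and> (\<forall>i<k. C i \<subset> C (Suc i))}"

definition hypersurface :: "'a topology \<Rightarrow> 'a set \<Rightarrow> bool" where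
  "hypersurface T X \<longleftrightarrow> closedin T X \<and> X \<noteq> {} \<and>
     (\<forall>Z. irreducible_component T X Z \<longrightarrow> codimension T Z = 1)"


subsection \<open>The Grassmannian and its Pluecker embedding\<close>

text \<open>\<open>Gr(3,n)\<close> with \<open>n = CARD('n)\<close>.\<close>

definition grassmannian3 :: "(complex^'n) set set" where
  "grassmannian3 = {W. vec.subspace W \<and> vec.dim W = 3}"

text \<open>The third exterior power of \<open>\<complex>\<^sup>n\<close>, realized as the space of alternating tensors.
  Antisymmetry under two adjacent transpositions suffices, the characteristic being 0.\<close>

definition wedge3 :: "(complex^('n::finite \<times> 'n \<times> 'n)) set" where
  "wedge3 = {t. \<forall>i j k. t $ (j, i, k) = - (t $ (i, j, k)) \<and> t $ (i, k, j) = - (t $ (i, j, k))}"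

text \<open>The minors of an \<open>n \<times> 3\<close> matrix; the rows of \<open>A\<close> are \<open>A $ i\<close>.\<close>

definition minors :: "complex^3^'n::finite \<Rightarrow> complex^('n \<times> 'n \<times> 'n)" where
  "minors A = (\<chi> t. case t of (i, j, k) \<Rightarrow> det (vector [A $ i, A $ j, A $ k] :: complex^3^3))"

text \<open>The tensors of minors for different bases of \<open>W\<close> differ by nonzero factors, so the span is
  a single line.\<close>

definition pluecker :: "(complex^'n::finite) set \<Rightarrow> (complex^('n \<times> 'n \<times> 'n)) set" where
  "pluecker W = vec.span {minors A | A. vec.span (columns A) = W}"

definition gr_variety :: "(complex^('n::finite \<times> 'n \<times> 'n)) set set" where
  "gr_variety = pluecker ` grassmannian3"

definition gr_zariski :: "(complex^('n::finite \<times> 'n \<times> 'n)) set topology" where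
  "gr_zariski = subtopology (zariski wedge3) gr_variety"


subsection \<open>Generic arrangements and dependency at infinity\<close>

text \<open>An arrangement is a family \<open>H\<close> of planes through the origin, labelled by \<open>'n\<close>.
  The normals are taken with respect to the bilinear (not the Hermitian) dot product.\<close>

definition normal_to :: "complex^3 \<Rightarrow> (complex^3) set \<Rightarrow> bool" where
  "normal_to a H \<longleftrightarrow> a \<noteq> 0 \<and> H = {v. (\<Sum>j\<in>UNIV. a $ j * v $ j) = 0}"

definition generic_arrangement :: "('n \<Rightarrow> (complex^3) set) \<Rightarrow> bool" where
  "generic_arrangement H \<longleftrightarrow> (\<forall>i. \<exists>a. normal_to a (H i)) \<and>
     (\<forall>i j k. i \<noteq> j \<and> i \<noteq> k \<and> j \<noteq> k \<longrightarrow> H i \<inter> H j \<inter> H k = {0})"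

definition gr_points :: "('n \<Rightarrow> (complex^3) set) \<Rightarrow> (complex^'n) set set" where
  "gr_points H = {vec.span (columns A) | A. \<forall>i. normal_to (A $ i) (H i)}"

text \<open>Projective 3-space is \<open>proj_space UNIV\<close> for \<open>complex^(3 option)\<close>; the coordinate \<open>None\<close> is the
  homogenizing one, and \<open>v\<close> in affine space is the point \<open>[1 : v]\<close>.\<close>

definition affine_point :: "complex^3 \<Rightarrow> (complex^(3 option)) set" where
  "affine_point v = vec.span {\<chi> i. case i of None \<Rightarrow> 1 | Some j \<Rightarrow> v $ j}"

definition infinity_plane :: "(complex^(3 option)) set set" where
  "infinity_plane = proj_space {x. x $ None = 0}"

definition trace_at_infinity :: "(complex^3) set \<Rightarrow> (complex^(3 option)) set set" where
  "trace_at_infinity H = (zariski UNIV closure_of (affine_point ` H)) \<inter> infinity_plane"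

text \<open>The smallest projective subspace containing a set of points.\<close>

definition proj_span :: "(complex^'m) set set \<Rightarrow> (complex^'m) set set" where
  "proj_span P = proj_space (vec.span (\<Union>P))"

definition dependent_lines :: "'n set \<Rightarrow> ('n \<Rightarrow> (complex^(3 option)) set set) \<Rightarrow> bool" where
  "dependent_lines S l \<longleftrightarrow>
     (\<exists>I1 I2 I3. I1 \<union> I2 \<union> I3 = S \<and>
        I1 \<inter> I2 = {} \<and> I1 \<inter> I3 = {} \<and> I2 \<inter> I3 = {} \<and>
        card I1 = 2 \<and> card I2 = 2 \<and> card I3 = 2 \<and>
        proj_span ((\<Inter>t\<in>I1. l t) \<union> (\<Inter>t\<in>I2. l t) \<union> (\<Inter>t\<in>I3. l t)) \<subset> infinity_plane)"

definition has_dependent_subarrangement :: "('n \<Rightarrow> (complex^3) set) \<Rightarrow> bool" where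
  "has_dependent_subarrangement H \<longleftrightarrow>
     (\<exists>S. card S = 6 \<and> dependent_lines S (\<lambda>i. trace_at_infinity (H i)))"

end

theory Submission
  imports Defs
begin

text \<open>Write \<open>[i j k]\<close> for the minors and \<open>a\<^sub>1, \<dots>, a\<^sub>6\<close> for the normals of six of the planes. The points at
  infinity of the pairs 12, 34, 56 are the cross products \<open>a\<^sub>1 \<times> a\<^sub>2\<close>, \<open>a\<^sub>3 \<times> a\<^sub>4\<close>, \<open>a\<^sub>5 \<times> a\<^sub>6\<close>, and their
  determinant is the quadric \<open>[125][346] - [126][345]\<close>; \<open>X\<close> is the union of its zero loci over all
  choices of the six indices.

  Such a locus is irreducible because it is the image of an affine space: the three points are
  collinear iff some \<open>v \<noteq> 0\<close> lies in a common plane with each of the three pairs, that is, iff the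
  normals have the form \<open>x u + y v\<close> with \<open>u\<close> depending on the pair only. It has codimension 1: in the
  chart with rows 1, 3, 5 equal to the unit vectors, the quadric is \<open>b z - r\<close> with \<open>z\<close> a coordinate and
  \<open>b\<close>, \<open>r\<close> not involving \<open>z\<close>. Up to a power of \<open>b\<close>, every form \<open>F\<close> is therefore \<open>(b z - r)\<^sup>k h\<close> in the chart,
  with \<open>h\<close> not vanishing identically on the locus, so an irreducible closed set that contains the locus and lies
  in the zeros of \<open>F\<close> is the locus itself.\<close>

subsection \<open>Polynomial functions and forms\<close>

text \<open>Polynomial functions instead of formal polynomials: only values matter below, and over
  an infinite field the two notions agree. The inductive form turns closure under substitution into
  an induction and admits any type of variables.\<close>

inductive polyfun :: "(('i \<Rightarrow> complex) \<Rightarrow> complex) \<Rightarrow> bool" where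
  polyfun_const: "polyfun (\<lambda>_. c)"
| polyfun_coord: "polyfun (\<lambda>p. p i)"
| polyfun_add: "polyfun f \<Longrightarrow> polyfun g \<Longrightarrow> polyfun (\<lambda>p. f p + g p)"
| polyfun_mult: "polyfun f \<Longrightarrow> polyfun g \<Longrightarrow> polyfun (\<lambda>p. f p * g p)"

named_theorems polyfun_intros
declare polyfun.intros [polyfun_intros]

lemma polyfun_minus [polyfun_intros]: "polyfun f \<Longrightarrow> polyfun (\<lambda>p. - f p)"
  using polyfun_mult[OF polyfun_const[of "-1"], of f] by simp

lemma polyfun_diff [polyfun_intros]: "polyfun f \<Longrightarrow> polyfun g \<Longrightarrow> polyfun (\<lambda>p. f p - g p)"
  using polyfun_add[OF _ polyfun_minus, of f g] by simp

lemma polyfun_sum [polyfun_intros]: "(\<And>i. i \<in> I \<Longrightarrow> polyfun (f i)) \<Longrightarrow> polyfun (\<lambda>p. \<Sum>i\<in>I. f i p)"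
  by (induction I rule: infinite_finite_induct) (auto intro: polyfun_intros)

lemma polyfun_prod [polyfun_intros]: "(\<And>i. i \<in> I \<Longrightarrow> polyfun (f i)) \<Longrightarrow> polyfun (\<lambda>p. \<Prod>i\<in>I. f i p)"
  by (induction I rule: infinite_finite_induct) (auto intro: polyfun_intros)

lemma polyfun_power [polyfun_intros]: "polyfun f \<Longrightarrow> polyfun (\<lambda>p. f p ^ k)"
  by (induction k) (auto intro: polyfun_intros)

lemma polyfun_compose:
  assumes "polyfun g" "\<And>i. polyfun (\<lambda>p. \<psi> p i)"
  shows "polyfun (\<lambda>p. g (\<psi> p))"
  using assms(1) by induction (auto intro: polyfun_intros assms(2))

lemma polyfun_update:
  assumes "polyfun f" "polyfun g"
  shows "polyfun (\<lambda>p. f (p(i := g p)))"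
proof (rule polyfun_compose[OF assms(1)])
  show "polyfun (\<lambda>p. (p(i := g p)) j)" for j
    by (cases "j = i") (auto intro: polyfun_intros assms)
qed

section \<open>Restriction to lines, absence of zero divisors, division by a variable\<close>

lemma polyfun_on_line:
  assumes "polyfun f"
  shows "\<exists>P. \<forall>t. f (\<lambda>i. p i + t * (q i - p i)) = poly P t"
  using assms
proof induction
  case (polyfun_const c)
  then show ?case by (intro exI[of _ "[:c:]"]) simp
next
  case (polyfun_coord i)
  then show ?case by (intro exI[of _ "[:p i, q i - p i:]"]) simp
next
  case (polyfun_add f g)
  then obtain P Q where "\<forall>t. f (\<lambda>i. p i + t * (q i - p i)) = poly P t"
    "\<forall>t. g (\<lambda>i. p i + t * (q i - p i)) = poly Q t" by auto
  then show ?case by (intro exI[of _ "P + Q"]) simp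
next
  case (polyfun_mult f g)
  then obtain P Q where "\<forall>t. f (\<lambda>i. p i + t * (q i - p i)) = poly P t"
    "\<forall>t. g (\<lambda>i. p i + t * (q i - p i)) = poly Q t" by auto
  then show ?case by (intro exI[of _ "P * Q"]) simp
qed

text \<open>Polynomial functions have no zero divisors. On the line joining \<open>p\<close> (at 0)
  to \<open>q\<close> (at 1) both factors become nonzero univariate polynomials, and their product
  has a point where it does not vanish.\<close>

lemma polyfun_nonzero_mult:
  assumes "polyfun f" "polyfun g" "f p \<noteq> 0" "g q \<noteq> 0"
  shows "\<exists>r. f r * g r \<noteq> 0"
proof -
  obtain P where P: "\<And>t. f (\<lambda>i. p i + t * (q i - p i)) = poly P t"
    using polyfun_on_line[OF assms(1)] by blast
  obtain Q where Q: "\<And>t. g (\<lambda>i. p i + t * (q i - p i)) = poly Q t"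
    using polyfun_on_line[OF assms(2)] by blast
  have "poly P 0 \<noteq> 0" "poly Q 1 \<noteq> 0"
    using P[of 0] Q[of 1] assms(3,4) by simp_all
  then have "P * Q \<noteq> 0" by auto
  then obtain t where "poly (P * Q) t \<noteq> 0"
    using poly_all_0_iff_0 by blast
  then show ?thesis
    using P Q by (metis poly_mult)
qed

text \<open>Division with remainder by the variable \<open>i\<close>; the quotient \<open>f1\<close>
  may still involve that variable.\<close>

lemma polyfun_split_variable:
  assumes "polyfun f"
  shows "\<exists>f1. polyfun f1 \<and> (\<forall>p. f p = f (p(i := 0)) + p i * f1 p)"
  using assms
proof induction
  case (polyfun_const c)
  then show ?case using polyfun.polyfun_const[of 0] by (intro exI[of _ "\<lambda>_. 0"]) simp
next
  case (polyfun_coord j)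
  have "polyfun (\<lambda>_ :: 'a \<Rightarrow> complex. if j = i then 1 else 0)"
    by (rule polyfun.polyfun_const)
  moreover have "p j = (p(i := 0)) j + p i * (if j = i then 1 else 0)" for p :: "'a \<Rightarrow> complex"
    by simp
  ultimately show ?case by blast
next
  case (polyfun_add f g)
  then obtain f1 where f1: "polyfun f1" "\<And>p. f p = f (p(i := 0)) + p i * f1 p" by blast
  from polyfun_add.IH obtain g1 where g1: "polyfun g1" "\<And>p. g p = g (p(i := 0)) + p i * g1 p" by blast
  note * = f1 g1
  have "f p + g p = f (p(i := 0)) + g (p(i := 0)) + p i * (f1 p + g1 p)" for p
    using *(2,4)[of p] by (simp add: algebra_simps)
  then show ?case
    using polyfun.polyfun_add[OF *(1,3)] by (intro exI[of _ "\<lambda>p. f1 p + g1 p"]) blast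
next
  case (polyfun_mult f g)
  then obtain f1 where f1: "polyfun f1" "\<And>p. f p = f (p(i := 0)) + p i * f1 p" by blast
  from polyfun_mult.IH obtain g1 where g1: "polyfun g1" "\<And>p. g p = g (p(i := 0)) + p i * g1 p" by blast
  note * = f1 g1
  have "f p * g p = f (p(i := 0)) * g (p(i := 0)) + p i * (f1 p * g p + f (p(i := 0)) * g1 p)" for p
  proof -
    define c where "c = f (p(i := 0))"
    define d where "d = g (p(i := 0))"
    show ?thesis
      using *(2,4)[of p] unfolding c_def[symmetric] d_def[symmetric] by algebra
  qed
  moreover have "polyfun (\<lambda>p. f1 p * g p + f (p(i := 0)) * g1 p)"
    using *(1,3) polyfun_mult.hyps polyfun_update[OF polyfun_mult.hyps(1) polyfun_const]
    by (intro polyfun_intros)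
  ultimately show ?case
    by (intro exI[of _ "\<lambda>p. f1 p * g p + f (p(i := 0)) * g1 p"]) blast
qed

text \<open>Splits off the highest power of the variable \<open>i\<close>: the last conjunct says
  that \<open>h\<close> is no longer divisible by it. The induction runs over the degree of
  \<open>g\<close> along the coordinate line through \<open>p\<close>; since \<open>g p\<close> is
  nonzero, the restriction never becomes the zero polynomial and each division lowers its
  degree.\<close>

lemma polyfun_factor_variable:
  assumes "polyfun g" "g p \<noteq> 0"
  shows "\<exists>k h r. polyfun h \<and> (\<forall>p. g p = p i ^ k * h p) \<and> h (r(i := 0)) \<noteq> 0"
proof -
  have "\<exists>P. \<forall>t. g (p(i := t)) = poly P t" if "polyfun g" for g
  proof -
    have eq: "(\<lambda>j. (p(i := 0)) j + t * ((p(i := 1)) j - (p(i := 0)) j)) = p(i := t)" for t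
      by auto
    show ?thesis
      using polyfun_on_line[OF that, of "p(i := 0)" "p(i := 1)"] unfolding eq .
  qed
  then obtain P where "\<And>t. g (p(i := t)) = poly P t"
    using assms(1) by blast
  with assms show ?thesis
  proof (induction "degree P" arbitrary: g P rule: less_induct)
    case less
    show ?case
    proof (cases "\<exists>r. g (r(i := 0)) \<noteq> 0")
      case True
      then show ?thesis
        using less.prems(1) by (intro exI[of _ 0]) auto
    next
      case False
      \<comment> \<open>Here \<open>g\<close> vanishes on the whole coordinate hyperplane, so
        division by the variable leaves no remainder.\<close>
      obtain g1 where g1: "polyfun g1" "\<And>p. g p = p i * g1 p"
        using polyfun_split_variable[OF less.prems(1), of i] False by auto
      obtain P1 where P1: "\<And>t. g1 (p(i := t)) = poly P1 t"
        using \<open>\<And>g. polyfun g \<Longrightarrow> \<exists>P. \<forall>t. g (p(i := t)) = poly P t\<close>[OF g1(1)] by blast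
      have "poly P = poly ([:0, 1:] * P1)"
        using less.prems(3) g1(2) P1 by (auto simp: fun_eq_iff)
      then have P: "P = [:0, 1:] * P1"
        by (simp only: poly_eq_poly_eq_iff)
      have "g1 p \<noteq> 0"
        using less.prems(2) g1(2) by auto
      then have "poly P1 (p i) \<noteq> 0"
        using P1[of "p i"] by simp
      then have "degree P1 < degree P"
        unfolding P by (subst degree_mult_eq) auto
      from less.hyps[OF this g1(1) \<open>g1 p \<noteq> 0\<close> P1]
      obtain k h r where "polyfun h" "\<forall>p. g1 p = p i ^ k * h p" "h (r(i := 0)) \<noteq> 0"
        by blast
      then show ?thesis
        by (intro exI[of _ "Suc k"] exI[of _ h] exI[of _ r]) (auto simp: g1(2))
    qed
  qed
qed

section \<open>Closure properties of forms and homogenization\<close>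

lemma form_const: "form 0 (\<lambda>x :: complex^'m. a)"
proof -
  have "{m :: 'm \<Rightarrow> nat. (\<Sum>i\<in>UNIV. m i) = 0} = {\<lambda>_. 0}"
    by auto
  then show ?thesis
    unfolding form_def by (intro exI[of _ "\<lambda>_. a"]) simp
qed

lemma form_coord: "form 1 (\<lambda>x :: complex^'m. x $ i)"
proof -
  define e where "e = (\<lambda>j. if j = i then 1 else 0 :: nat)"
  define E where "E = {m :: 'm \<Rightarrow> nat. (\<Sum>i\<in>UNIV. m i) = 1}"
  have E: "finite E" "e \<in> E"
    by (simp_all only: E_def finite_exponents) (simp add: e_def)
  have "(\<Sum>m\<in>E. (if e = m then 1 else 0) * (\<Prod>i\<in>UNIV. x $ i ^ m i)) = x $ i"
    for x :: "complex^'m"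
  proof -
    have "(\<Sum>m\<in>E. (if e = m then 1 else 0) * (\<Prod>i\<in>UNIV. x $ i ^ m i))
        = (\<Sum>m\<in>E. if e = m then \<Prod>i\<in>UNIV. x $ i ^ m i else 0)"
      by (rule sum.cong) simp_all
    also have "\<dots> = (\<Prod>j\<in>UNIV. x $ j ^ e j)"
      using E by (simp only: sum.delta' if_True)
    also have "\<dots> = (\<Prod>j\<in>UNIV. if j = i then x $ j else 1)"
      by (rule prod.cong) (simp_all add: e_def)
    finally show ?thesis by simp
  qed
  then show ?thesis
    unfolding form_def E_def by (intro exI[of _ "\<lambda>m. if e = m then 1 else 0"] allI) (rule sym)
qed

lemma form_add:
  fixes F G :: "complex^'m \<Rightarrow> complex"
  assumes "form d F" "form d G"
  shows "form d (\<lambda>x. F x + G x)"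
proof -
  obtain a where a: "\<And>x. F x = (\<Sum>m\<in>{m. (\<Sum>i\<in>UNIV. m i) = d}. a m * (\<Prod>i\<in>UNIV. x $ i ^ m i))"
    using assms(1) unfolding form_def by blast
  obtain b where b: "\<And>x. G x = (\<Sum>m\<in>{m. (\<Sum>i\<in>UNIV. m i) = d}. b m * (\<Prod>i\<in>UNIV. x $ i ^ m i))"
    using assms(2) unfolding form_def by blast
  show ?thesis
    unfolding form_def
    by (intro exI[of _ "\<lambda>m. a m + b m"]) (simp add: a b sum.distrib distrib_right)
qed

lemma form_cmult: "form d F \<Longrightarrow> form d (\<lambda>x. a * F x)"
  using form_mult[OF form_const, of d F a] by simp

lemma form_power_coord: "form e (\<lambda>x. x $ i ^ e)"
proof (induction e)
  case (Suc e)
  then show ?case using form_mult[OF form_coord[of i] Suc] by simp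
qed (simp add: form_one)

lemma polyfun_form:
  assumes "form d F" "\<And>i. polyfun (\<lambda>p. \<psi> p $ i)"
  shows "polyfun (\<lambda>p. F (\<psi> p))"
proof -
  obtain a where a: "\<And>x. F x = (\<Sum>m\<in>{m. (\<Sum>i\<in>UNIV. m i) = d}. a m * (\<Prod>i\<in>UNIV. x $ i ^ m i))"
    using assms(1) unfolding form_def by blast
  show ?thesis unfolding a by (intro polyfun_intros assms)
qed

text \<open>Passes from polynomial functions on an affine chart back to forms, so that closed sets
  can be described in the chart. The degree is whatever the induction yields.\<close>

lemma polyfun_homogenize:
  assumes "polyfun (g :: ('m::finite \<Rightarrow> complex) \<Rightarrow> complex)"
  shows "\<exists>d G. form d G \<and> (\<forall>x. x $ i0 = 1 \<longrightarrow> G x = g (($) x))"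
  using assms
proof induction
  case (polyfun_const c)
  then show ?case using form_const by blast
next
  case (polyfun_coord i)
  then show ?case using form_coord by blast
next
  case (polyfun_add f g)
  then obtain d F e G where *: "form d F" "\<And>x. x $ i0 = 1 \<Longrightarrow> F x = f (($) x)"
    "form e G" "\<And>x. x $ i0 = 1 \<Longrightarrow> G x = g (($) x)" by metis
  \<comment> \<open>Powers of the coordinate \<open>i0\<close>, which equals 1 on the chart, bring
    both summands to the common degree.\<close>
  have "form (d + e) (\<lambda>x. x $ i0 ^ e * F x + x $ i0 ^ d * G x)"
    using form_add[OF form_mult[OF form_power_coord[of e i0] *(1)]]
      form_mult[OF form_power_coord[of d i0] *(3)] by (simp add: add.commute)
  then show ?case using *
    by (intro exI[of _ "d + e"] exI[of _ "\<lambda>x. x $ i0 ^ e * F x + x $ i0 ^ d * G x"]) auto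
next
  case (polyfun_mult f g)
  then obtain d F e G where *: "form d F" "\<And>x. x $ i0 = 1 \<Longrightarrow> F x = f (($) x)"
    "form e G" "\<And>x. x $ i0 = 1 \<Longrightarrow> G x = g (($) x)" by metis
  then show ?case using form_mult[OF *(1,3)]
    by (intro exI[of _ "d + e"] exI[of _ "\<lambda>x. F x * G x"]) (auto simp: *)
qed


subsection \<open>Minors and the points of the Grassmannian\<close>

definition det3 :: "complex^3 \<Rightarrow> complex^3 \<Rightarrow> complex^3 \<Rightarrow> complex" where
  "det3 a b c = det (vector [a, b, c] :: complex^3^3)"

lemma det3_expand:
  "det3 a b c = a $ 1 * b $ 2 * c $ 3 + a $ 2 * b $ 3 * c $ 1 + a $ 3 * b $ 1 * c $ 2
              - a $ 1 * b $ 3 * c $ 2 - a $ 2 * b $ 1 * c $ 3 - a $ 3 * b $ 2 * c $ 1"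
  by (simp add: det3_def det_3)

lemma minors_nth: "minors A $ (i, j, k) = det3 (A $ i) (A $ j) (A $ k)"
  by (simp add: minors_def det3_def)

lemma minors_in_wedge3: "minors A \<in> wedge3"
  by (simp add: wedge3_def minors_nth det3_expand)

lemma det3_mult: "det3 (a v* C) (b v* C) (c v* C) = det C * det3 a b c"
proof -
  have "(vector [a v* C, b v* C, c v* C] :: complex^3^3) = vector [a, b, c] ** C"
    by (simp add: vec_eq_iff forall_3 matrix_matrix_mult_def vector_matrix_mult_def sum_3 mult.commute)
  then show ?thesis
    by (simp add: det3_def det_mul mult.commute)
qed

lemma matrix_mult_row: "(A ** C) $ i = A $ i v* C"
  by (simp add: vec_eq_iff matrix_matrix_mult_def vector_matrix_mult_def mult.commute)

text \<open>Right multiplication by an invertible matrix is a change of basis of the column space;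
  the common factor shows that the projective point is unchanged.\<close>

lemma minors_mult: "minors (A ** C) = det C *s minors A"
  by (simp add: vec_eq_iff minors_nth matrix_mult_row det3_mult split_paired_all)

abbreviation bdot :: "complex^3 \<Rightarrow> complex^3 \<Rightarrow> complex" where
  "bdot a v \<equiv> \<Sum>j\<in>UNIV. a $ j * v $ j"

lemma det3_nonzero_kernel:
  assumes "det3 a b c \<noteq> 0" "bdot a x = 0" "bdot b x = 0" "bdot c x = 0"
  shows "x = 0"
proof -
  let ?M = "vector [a, b, c] :: complex^3^3"
  have "?M *v x = 0"
    using assms(2-4) by (simp add: vec_eq_iff forall_3 matrix_vector_mult_def)
  moreover have "invertible ?M"
    using assms(1) by (simp add: invertible_det_nz det3_def)
  ultimately show ?thesis
    by (metis invertible_left_inverse matrix_left_invertible_ker)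
qed

lemma det3_zero_kernel:
  assumes "det3 a b c = 0"
  obtains x where "x \<noteq> 0" "bdot a x = 0" "bdot b x = 0" "bdot c x = 0"
proof -
  let ?M = "vector [a, b, c] :: complex^3^3"
  have "\<not> invertible ?M"
    using assms by (simp add: invertible_det_nz det3_def)
  then obtain x where x: "x \<noteq> 0" "?M *v x = 0"
    by (metis invertible_left_inverse matrix_left_invertible_ker)
  from x(2) have "bdot a x = 0" "bdot b x = 0" "bdot c x = 0"
    by (simp_all add: vec_eq_iff forall_3 matrix_vector_mult_def)
  with x(1) show ?thesis
    by (rule that)
qed

text \<open>Apply the kernel criterion to the transpose: the entries of a kernel vector are the
  coefficients of the relation.\<close>

lemma det3_zero_dependent:
  assumes "det3 a b c = 0"
  obtains x y z where "x *s a + y *s b + z *s c = 0" "x \<noteq> 0 \<or> y \<noteq> 0 \<or> z \<noteq> 0"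
proof -
  let ?a = "vector [a $ 1, b $ 1, c $ 1] :: complex^3"
  let ?b = "vector [a $ 2, b $ 2, c $ 2] :: complex^3"
  let ?c = "vector [a $ 3, b $ 3, c $ 3] :: complex^3"
  have "det3 ?a ?b ?c = 0"
    using assms by (simp add: det3_expand algebra_simps)
  then obtain x where x: "x \<noteq> 0" "bdot ?a x = 0" "bdot ?b x = 0" "bdot ?c x = 0"
    by (rule det3_zero_kernel)
  show ?thesis
  proof (rule that[of "x $ 1" "x $ 2" "x $ 3"])
    show "x $ 1 *s a + x $ 2 *s b + x $ 3 *s c = 0"
      using x(2-4) by (simp add: vec_eq_iff forall_3 sum_3 mult.commute)
    show "x $ 1 \<noteq> 0 \<or> x $ 2 \<noteq> 0 \<or> x $ 3 \<noteq> 0"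
      using x(1) by (simp add: vec_eq_iff forall_3)
  qed
qed

lemma det3_sum:
  "det3 (\<Sum>i\<in>I. f i) b c = (\<Sum>i\<in>I. det3 (f i) b c)"
  "det3 a (\<Sum>i\<in>I. f i) c = (\<Sum>i\<in>I. det3 a (f i) c)"
  "det3 a b (\<Sum>i\<in>I. f i) = (\<Sum>i\<in>I. det3 a b (f i))"
  by (simp_all add: det3_expand sum.distrib sum_subtractf sum_distrib_left sum_distrib_right)

lemma det3_cmult:
  "det3 (x *s a) b c = x * det3 a b c" "det3 a (x *s b) c = x * det3 a b c"
  "det3 a b (x *s c) = x * det3 a b c"
  by (simp_all add: det3_expand algebra_simps)

section \<open>Full column rank and nonvanishing minors\<close>

lemma matrix_mult_axis: "A *v axis j 1 = column j (A :: complex^'m^'n)"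
  by (simp add: vec_eq_iff matrix_vector_mult_def column_def axis_def if_distrib cong: if_cong)

lemma columns_eq_range: "columns A = range (\<lambda>j. column j A)"
  by (auto simp: columns_def)

lemma span_columns: "vec.span (columns A) = range ((*v) (A :: complex^'m^'n))"
proof
  show "range ((*v) A) \<subseteq> vec.span (columns A)"
    using matrix_vector_mult_in_columnspace_gen by auto
  have "columns A \<subseteq> range ((*v) A)"
    unfolding columns_eq_range matrix_mult_axis[symmetric] by blast
  moreover have "vec.subspace (range ((*v) A))"
    using vec.subspace_UNIV by (intro vec.linear_subspace_image) auto
  ultimately show "vec.span (columns A) \<subseteq> range ((*v) A)"
    by (rule vec.span_minimal)
qed

lemma minors_nonzero_inj:
  assumes "minors A \<noteq> 0"
  shows "inj ((*v) A)"
proof -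
  obtain i j k where "det3 (A $ i) (A $ j) (A $ k) \<noteq> 0"
    using assms by (auto simp: vec_eq_iff minors_nth)
  then have "x = 0" if "A *v x = 0" for x
    using that by (intro det3_nonzero_kernel[of "A $ i" "A $ j" "A $ k"])
      (auto simp: vec_eq_iff matrix_vector_mult_def)
  then show ?thesis
    by (simp add: vec.inj_iff_eq_0)
qed

text \<open>The rows of \<open>B ** A\<close>, for a left inverse \<open>B\<close>, are combinations
  of rows of \<open>A\<close>. By trilinearity the determinant 1 of the identity would be a
  combination of vanishing minors.\<close>

lemma inj_minors_nonzero:
  fixes A :: "complex^3^'n"
  assumes "inj ((*v) A)"
  shows "minors A \<noteq> 0"
proof
  assume 0: "minors A = 0"
  obtain B :: "complex^'n^3" where B: "B ** A = mat 1"
    using assms matrix_left_invertible_injective by blast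
  have row: "(B ** A) $ r = (\<Sum>i\<in>UNIV. B $ r $ i *s A $ i)" for r
    by (simp add: vec_eq_iff matrix_matrix_mult_def)
  have "det3 (A $ i) (A $ j) (A $ k) = 0" for i j k
    using 0 by (metis minors_nth zero_index)
  then have "det3 ((B ** A) $ 1) ((B ** A) $ 2) ((B ** A) $ 3) = 0"
    unfolding row by (simp add: det3_sum det3_cmult)
  moreover have "det3 (mat 1 $ 1) (mat 1 $ 2) (mat 1 $ 3) = 1"
    by (simp add: det3_expand mat_def)
  ultimately show False
    using B by simp
qed

lemma span_columns_in_grassmannian3_iff:
  fixes A :: "complex^3^'n"
  shows "vec.span (columns A) \<in> grassmannian3 \<longleftrightarrow> minors A \<noteq> 0"
proof
  assume "minors A \<noteq> 0"
  then have "vec.dim (range ((*v) A)) = vec.dim (UNIV :: (complex^3) set)"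
    by (intro vec.dim_image_eq) (auto dest: minors_nonzero_inj)
  then show "vec.span (columns A) \<in> grassmannian3"
    by (simp add: grassmannian3_def span_columns[symmetric] card_cart_basis)
next
  assume "vec.span (columns A) \<in> grassmannian3"
  then have dim: "vec.dim (columns A) = 3"
    by (simp add: grassmannian3_def)
  note col = columns_eq_range[of A]
  \<comment> \<open>\<open>columns A\<close> is a set, so equal columns would collapse; dimension 3
    forces three distinct, independent columns.\<close>
  have "card (columns A) \<le> 3"
    unfolding col using card_image_le[of "UNIV :: 3 set" "\<lambda>j. column j A"] by simp
  moreover have "3 \<le> card (columns A)"
    using dim vec.dim_le_card'[of "columns A"] by (simp add: col)
  ultimately have card: "card (columns A) = 3" by simp
  then have inj: "inj (\<lambda>j. column j A)"
    unfolding col by (intro eq_card_imp_inj_on) auto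
  have ind: "vec.independent (columns A)"
    using vec.card_eq_dim[of "columns A" "columns A"] dim card vec.span_superset[of "columns A"]
    by (simp add: col)
  have "x = 0" if "A *v x = 0" for x
  proof -
    \<comment> \<open>Independence of a set asks for coefficients indexed by the vectors themselves,
      so \<open>x\<close> is transported along the inverse of the column map.\<close>
    define u where "u = (\<lambda>w. x $ (inv (\<lambda>j. column j A) w))"
    have "(\<Sum>w\<in>columns A. u w *s w) = (\<Sum>j\<in>UNIV. x $ j *s column j A)"
      unfolding col using inj inv_f_f[OF inj] by (subst sum.reindex) (auto simp: u_def)
    also have "\<dots> = 0"
      using that by (simp add: matrix_mult_sum)
    finally have "(\<Sum>w\<in>columns A. u w *s w) = 0" .
    then have "u w = 0" if "w \<in> columns A" for w
      using ind that by (auto simp: vec.independent_explicit)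
    then have "u (column j A) = 0" for j
      by (simp add: col)
    then show "x = 0"
      using inv_f_f[OF inj] by (simp add: vec_eq_iff u_def)
  qed
  then have "inj ((*v) A)"
    by (simp add: vec.inj_iff_eq_0)
  then show "minors A \<noteq> 0"
    by (rule inj_minors_nonzero)
qed

lemma grassmannian3_obtains:
  assumes "W \<in> grassmannian3"
  obtains A :: "complex^3^'n" where "W = vec.span (columns A)"
proof -
  obtain B where B: "B \<subseteq> W" "vec.independent B" "W \<subseteq> vec.span B" "card B = vec.dim W"
    using vec.basis_exists by metis
  have "vec.subspace W" "card B = 3"
    using assms B by (auto simp: grassmannian3_def)
  moreover have "vec.span B = W"
    using B \<open>vec.subspace W\<close> by (metis subset_antisym vec.span_minimal)
  moreover obtain a b c where "B = {a, b, c}"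
    using \<open>card B = 3\<close> by (metis card_3_iff)
  define A :: "complex^3^'n" where "A = transpose (vector [a, b, c])"
  have "column 1 A = a" "column 2 A = b" "column 3 A = c"
    by (simp_all add: A_def column_def transpose_def vec_lambda_eta)
  then have "columns A = B"
    by (simp add: \<open>B = {a, b, c}\<close> columns_eq_range UNIV_3)
  ultimately show ?thesis
    using that by metis
qed

text \<open>Any matrix with the same column space is \<open>A\<close> times a 3 by 3 matrix, so its
  minors are a multiple of those of \<open>A\<close>.\<close>

lemma pluecker_eq:
  assumes "minors A \<noteq> 0"
  shows "pluecker (vec.span (columns A)) = vec.span {minors A}"
proof -
  have "minors B \<in> vec.span {minors A}" if "vec.span (columns B) = vec.span (columns A)" for B
  proof -
    have "column j B \<in> range ((*v) A)" for j
      using that by (metis matrix_mult_axis rangeI span_columns)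
    then have "\<forall>j. \<exists>v. column j B = A *v v"
      by blast
    then obtain x where x: "\<And>j. column j B = A *v x j"
      by metis
    have "B $ i $ j = (A ** (\<chi> i j. x j $ i)) $ i $ j" for i j
      using arg_cong[OF x[of j], of "\<lambda>v. v $ i"]
      by (simp add: column_def matrix_vector_mult_def matrix_matrix_mult_def)
    then have "B = A ** (\<chi> i j. x j $ i)"
      by (simp add: vec_eq_iff)
    then have "minors B = det (\<chi> i j. x j $ i) *s minors A"
      by (simp only: minors_mult)
    then show ?thesis
      by (auto simp: vec.span_singleton)
  qed
  then have "{minors B | B. vec.span (columns B) = vec.span (columns A)} \<subseteq> vec.span {minors A}" (is "?S \<subseteq> _")
    by blast
  then have "vec.span ?S \<subseteq> vec.span {minors A}"
    by (rule vec.span_minimal[OF _ vec.subspace_span])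
  moreover have "vec.span {minors A} \<subseteq> vec.span ?S"
    by (rule vec.span_mono) blast
  ultimately show ?thesis
    unfolding pluecker_def by (rule subset_antisym)
qed

text \<open>Replaces subspaces by matrices of full rank, the form in which all points of the variety
  are handled from here on.\<close>

lemma gr_variety_eq: "gr_variety = {vec.span {minors A} | A :: complex^3^'n. minors A \<noteq> 0}"
proof (intro subset_antisym subsetI)
  fix L :: "(complex^('n \<times> 'n \<times> 'n)) set" assume "L \<in> gr_variety"
  then obtain W :: "(complex^'n) set" where W: "W \<in> grassmannian3" "L = pluecker W"
    by (auto simp: gr_variety_def)
  obtain A :: "complex^3^'n" where A: "W = vec.span (columns A)"
    using grassmannian3_obtains[OF W(1)] .
  have "minors A \<noteq> 0"
    using W(1) span_columns_in_grassmannian3_iff[of A] unfolding A by simp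
  then show "L \<in> {vec.span {minors A} | A :: complex^3^'n. minors A \<noteq> 0}"
    using W(2) pluecker_eq[of A] unfolding A by blast
next
  fix L :: "(complex^('n \<times> 'n \<times> 'n)) set" assume "L \<in> {vec.span {minors A} | A :: complex^3^'n. minors A \<noteq> 0}"
  then obtain A :: "complex^3^'n" where A: "minors A \<noteq> 0" "L = vec.span {minors A}"
    by blast
  then have "vec.span (columns A) \<in> grassmannian3" "L = pluecker (vec.span (columns A))"
    using span_columns_in_grassmannian3_iff[of A] pluecker_eq[of A] by simp_all
  then show "L \<in> gr_variety"
    unfolding gr_variety_def by blast
qed

lemma span_singleton_in_proj_space:
  "v \<noteq> 0 \<Longrightarrow> v \<in> V \<Longrightarrow> vec.subspace V \<Longrightarrow> vec.span {v} \<in> proj_space V"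
  by (simp add: proj_space_def vec.span_minimal)

lemma subspace_wedge3: "vec.subspace (wedge3 :: (complex^('n::finite \<times> 'n \<times> 'n)) set)"
proof (rule vec.subspaceI)
  show "0 \<in> wedge3"
    by (simp add: wedge3_def)
next
  fix x y :: "complex^('n \<times> 'n \<times> 'n)" assume "x \<in> wedge3" "y \<in> wedge3"
  then have *: "x $ (j, i, k) = - x $ (i, j, k)" "x $ (i, k, j) = - x $ (i, j, k)"
    "y $ (j, i, k) = - y $ (i, j, k)" "y $ (i, k, j) = - y $ (i, j, k)" for i j k
    unfolding wedge3_def by blast+
  show "x + y \<in> wedge3"
    unfolding wedge3_def mem_Collect_eq vector_add_component
  proof (intro allI conjI)
    fix i j k
    show "x $ (j, i, k) + y $ (j, i, k) = - (x $ (i, j, k) + y $ (i, j, k))"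
      using *(1)[of j i k] *(3)[of j i k] by simp
    show "x $ (i, k, j) + y $ (i, k, j) = - (x $ (i, j, k) + y $ (i, j, k))"
      using *(2)[of i k j] *(4)[of i k j] by simp
  qed
next
  fix c and x :: "complex^('n \<times> 'n \<times> 'n)" assume "x \<in> wedge3"
  then have *: "x $ (j, i, k) = - x $ (i, j, k)" "x $ (i, k, j) = - x $ (i, j, k)" for i j k
    unfolding wedge3_def by blast+
  show "c *s x \<in> wedge3"
    unfolding wedge3_def mem_Collect_eq vector_smult_component
  proof (intro allI conjI)
    fix i j k
    show "c * x $ (j, i, k) = - (c * x $ (i, j, k))"
      using *(1)[of j i k] by simp
    show "c * x $ (i, k, j) = - (c * x $ (i, j, k))"
      using *(2)[of i k j] by simp
  qed
qed

lemma gr_variety_subset: "gr_variety \<subseteq> proj_space (wedge3 :: (complex^('n::finite \<times> 'n \<times> 'n)) set)"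
  unfolding gr_variety_eq using span_singleton_in_proj_space[OF _ minors_in_wedge3 subspace_wedge3] by blast


subsection \<open>Concurrence loci and their irreducibility\<close>

text \<open>Keeps indices such as \<open>s 1\<close> from being rewritten to
  \<open>s (Suc 0)\<close>.\<close>

declare One_nat_def [simp del]

section \<open>Closed and irreducible subsets of the Grassmannian in terms of matrices\<close>

lemma form_zero_on_span:
  assumes "form d F"
  shows "(\<forall>x\<in>vec.span {v}. F x = 0) \<longleftrightarrow> F v = 0"
proof
  show "\<forall>x\<in>vec.span {v}. F x = 0 \<Longrightarrow> F v = 0"
    by (simp add: vec.span_base)
  show "F v = 0 \<Longrightarrow> \<forall>x\<in>vec.span {v}. F x = 0"
    using form_scale[OF assms] by (auto simp: vec.span_singleton)
qed

abbreviation gr_point :: "complex^3^'n::finite \<Rightarrow> (complex^('n \<times> 'n \<times> 'n)) set" where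
  "gr_point A \<equiv> vec.span {minors A}"

lemma gr_point_in_gr_variety: "minors A \<noteq> 0 \<Longrightarrow> gr_point A \<in> gr_variety"
  by (auto simp: gr_variety_eq)

lemma gr_point_in_proj_zeros_iff:
  assumes "minors A \<noteq> 0" "\<And>F. F \<in> S \<Longrightarrow> \<exists>d. form d F"
  shows "gr_point A \<in> proj_zeros wedge3 S \<longleftrightarrow> (\<forall>F\<in>S. F (minors A) = 0)"
proof -
  have "gr_point A \<in> proj_space wedge3"
    by (intro span_singleton_in_proj_space assms minors_in_wedge3 subspace_wedge3)
  then show ?thesis
    unfolding proj_zeros_def using assms(2) form_zero_on_span by blast
qed

lemma topspace_gr_zariski: "topspace gr_zariski = gr_variety"
  using gr_variety_subset by (auto simp: gr_zariski_def topspace_zariski)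

lemma closedin_gr_zariski_forms:
  assumes "\<And>F. F \<in> S \<Longrightarrow> \<exists>d. form d F"
  shows "closedin gr_zariski (gr_variety \<inter> proj_zeros wedge3 S)"
  unfolding gr_zariski_def closedin_subtopology closedin_zariski using assms by blast

lemma closedin_gr_zariski_imp_forms:
  assumes "closedin gr_zariski C"
  shows "\<exists>S. (\<forall>F\<in>S. \<exists>d. form d F) \<and>
    (\<forall>A. minors A \<noteq> 0 \<longrightarrow> (gr_point A \<in> C \<longleftrightarrow> (\<forall>F\<in>S. F (minors A) = 0)))"
proof -
  obtain S where S: "\<forall>F\<in>S. \<exists>d. form d F" "C = proj_zeros wedge3 S \<inter> gr_variety"
    using assms unfolding gr_zariski_def closedin_subtopology closedin_zariski by blast
  have "gr_point A \<in> C \<longleftrightarrow> (\<forall>F\<in>S. F (minors A) = 0)" if "minors A \<noteq> 0" for A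
    using gr_point_in_proj_zeros_iff[of A S] gr_point_in_gr_variety[of A] S that by blast
  with S(1) show ?thesis
    by blast
qed

lemma polyfun_minors:
  assumes "\<And>i j. polyfun (\<lambda>p. \<Phi> p $ i $ j)"
  shows "polyfun (\<lambda>p. minors (\<Phi> p) $ t)"
proof -
  obtain i j k where "t = (i, j, k)"
    by (cases t)
  then show ?thesis
    by (simp only: minors_nth det3_expand) (intro polyfun_intros assms)
qed

text \<open>The image of an affine space under a polynomial map is irreducible. If neither closed
  set contains the image, two forms, one for each set, pull back to nonzero polynomial functions; a
  parameter where both are nonzero gives a point of the image outside both sets.\<close>

lemma irreducible_in_gr_param:
  fixes \<Phi> :: "('i \<Rightarrow> complex) \<Rightarrow> complex^3^'n::finite"
  assumes poly: "\<And>i j. polyfun (\<lambda>p. \<Phi> p $ i $ j)" and ex: "minors (\<Phi> p) \<noteq> 0"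
  shows "irreducible_in gr_zariski {gr_point (\<Phi> p) | p. minors (\<Phi> p) \<noteq> 0}" (is "irreducible_in _ ?Z")
  unfolding irreducible_in_def
proof (intro conjI allI impI)
  show "?Z \<subseteq> topspace gr_zariski"
    by (auto simp: topspace_gr_zariski gr_point_in_gr_variety)
  show "?Z \<noteq> {}"
    using ex by blast
  fix C D assume "closedin gr_zariski C \<and> closedin gr_zariski D \<and> ?Z \<subseteq> C \<union> D"
  then have CD: "closedin gr_zariski C" "closedin gr_zariski D" "?Z \<subseteq> C \<union> D"
    by blast+
  obtain S where S: "\<And>F. F \<in> S \<Longrightarrow> \<exists>d. form d F"
    "\<And>A. minors A \<noteq> 0 \<Longrightarrow> gr_point A \<in> C \<longleftrightarrow> (\<forall>F\<in>S. F (minors A) = 0)"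
    using closedin_gr_zariski_imp_forms[OF CD(1)] by blast
  obtain T where T: "\<And>F. F \<in> T \<Longrightarrow> \<exists>d. form d F"
    "\<And>A. minors A \<noteq> 0 \<Longrightarrow> gr_point A \<in> D \<longleftrightarrow> (\<forall>F\<in>T. F (minors A) = 0)"
    using closedin_gr_zariski_imp_forms[OF CD(2)] by blast
  show "?Z \<subseteq> C \<or> ?Z \<subseteq> D"
  proof (rule ccontr)
    assume "\<not> ?thesis"
    then obtain p q where p: "minors (\<Phi> p) \<noteq> 0" "gr_point (\<Phi> p) \<notin> C"
      and q: "minors (\<Phi> q) \<noteq> 0" "gr_point (\<Phi> q) \<notin> D" by blast
    obtain F where F: "F \<in> S" "F (minors (\<Phi> p)) \<noteq> 0"
      using S(2) p by blast
    obtain G where G: "G \<in> T" "G (minors (\<Phi> q)) \<noteq> 0"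
      using T(2) q by blast
    obtain t where t: "minors (\<Phi> p) $ t \<noteq> 0"
      using p(1) by (auto simp: vec_eq_iff)
    obtain d e where "form d F" "form e G"
      using S(1)[OF F(1)] T(1)[OF G(1)] by blast
    then have FG: "polyfun (\<lambda>p. F (minors (\<Phi> p)))" "polyfun (\<lambda>p. G (minors (\<Phi> p)))"
      by (auto intro!: polyfun_form[OF _ polyfun_minors[OF poly]])
    define f g h where "f = (\<lambda>p. F (minors (\<Phi> p)))" and "g = (\<lambda>p. G (minors (\<Phi> p)))"
      and "h = (\<lambda>p. minors (\<Phi> p) $ t)"
    note fgh_defs = this
    have fgh: "polyfun f" "polyfun g" "polyfun h" "f p \<noteq> 0" "g q \<noteq> 0" "h p \<noteq> 0"
      using FG F(2) G(2) t polyfun_minors[OF poly] by (simp_all add: fgh_defs)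
    obtain r where r: "f r * g r \<noteq> 0"
      using polyfun_nonzero_mult[of f g p q, OF fgh(1,2,4,5)] by blast
    \<comment> \<open>The third factor \<open>h\<close>, a single minor, ensures that the common
      parameter has full rank and thus yields a point of the Grassmannian.\<close>
    obtain r' where "f r' * g r' * h r' \<noteq> 0"
      using polyfun_nonzero_mult[of "\<lambda>p. f p * g p" h r p] polyfun_mult[OF fgh(1,2)] fgh(3) r fgh(6) by blast
    then have "F (minors (\<Phi> r')) \<noteq> 0" "G (minors (\<Phi> r')) \<noteq> 0" "minors (\<Phi> r') \<noteq> 0"
      by (auto simp: fgh_defs)
    then have "gr_point (\<Phi> r') \<notin> C" "gr_point (\<Phi> r') \<notin> D" "gr_point (\<Phi> r') \<in> ?Z"
      using S(2) T(2) F(1) G(1) by blast+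
    then show False
      using CD(3) by blast
  qed
qed

section \<open>The bilinear cross product and the concurrence quadric\<close>

definition ccross :: "complex^3 \<Rightarrow> complex^3 \<Rightarrow> complex^3" where
  "ccross a b = vector [a $ 2 * b $ 3 - a $ 3 * b $ 2, a $ 3 * b $ 1 - a $ 1 * b $ 3, a $ 1 * b $ 2 - a $ 2 * b $ 1]"

lemma ccross_nth [simp]:
  "ccross a b $ 1 = a $ 2 * b $ 3 - a $ 3 * b $ 2"
  "ccross a b $ 2 = a $ 3 * b $ 1 - a $ 1 * b $ 3"
  "ccross a b $ 3 = a $ 1 * b $ 2 - a $ 2 * b $ 1"
  by (simp_all add: ccross_def)

lemma bdot_ccross: "bdot (ccross a b) v = det3 v a b"
  by (simp add: sum_3 det3_expand algebra_simps)

text \<open>The name refers to the dual picture: in the plane of normals, the three lines that join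
  the two members of each pair pass through one point. Only the values of \<open>s\<close> at 1,
  ..., 6 matter.\<close>

definition concurrence :: "(nat \<Rightarrow> 'n) \<Rightarrow> complex^('n::finite \<times> 'n \<times> 'n) \<Rightarrow> complex" where
  "concurrence s t = t $ (s 1, s 2, s 5) * t $ (s 3, s 4, s 6) - t $ (s 1, s 2, s 6) * t $ (s 3, s 4, s 5)"

lemma ccross_ccross: "ccross (ccross c d) (ccross e f) = det3 c d f *s e - det3 c d e *s f"
  by (simp add: vec_eq_iff forall_3 det3_expand algebra_simps)

text \<open>The determinant is the product of the first cross product with the cross product of the
  other two, and \<open>ccross_ccross\<close> writes the latter as a combination of \<open>e\<close>
  and \<open>f\<close>.\<close>

lemma det3_ccross:
  "det3 (ccross a b) (ccross c d) (ccross e f) = det3 a b e * det3 c d f - det3 a b f * det3 c d e"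
proof -
  let ?v = "det3 c d f *s e - det3 c d e *s f"
  have "det3 (ccross a b) (ccross c d) (ccross e f) = bdot ?v (ccross a b)"
    unfolding bdot_ccross[symmetric] ccross_ccross ..
  also have "\<dots> = det3 c d f * det3 e a b - det3 c d e * det3 f a b"
    by (simp add: sum_3 flip: bdot_ccross) (simp add: algebra_simps)
  also have "\<dots> = det3 a b e * det3 c d f - det3 a b f * det3 c d e"
    by (simp add: det3_expand[of e] det3_expand[of f] det3_expand[of a] algebra_simps)
  finally show ?thesis .
qed

lemma concurrence_minors:
  "concurrence s (minors A) =
     det3 (ccross (A $ s 1) (A $ s 2)) (ccross (A $ s 3) (A $ s 4)) (ccross (A $ s 5) (A $ s 6))"
  by (simp add: concurrence_def minors_nth det3_ccross)

lemma form_concurrence: "form 2 (concurrence s)"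
proof -
  have "form 2 (\<lambda>t. t $ (s 1, s 2, s 5) * t $ (s 3, s 4, s 6) + (- 1) * (t $ (s 1, s 2, s 6) * t $ (s 3, s 4, s 5)))"
    using form_add[OF form_mult[OF form_coord form_coord] form_cmult[OF form_mult[OF form_coord form_coord]]]
    unfolding one_add_one .
  then show ?thesis
    by (simp add: concurrence_def[abs_def])
qed

definition concurrence_locus :: "(nat \<Rightarrow> 'n::finite) \<Rightarrow> (complex^('n \<times> 'n \<times> 'n)) set set" where
  "concurrence_locus s = gr_variety \<inter> proj_zeros wedge3 {concurrence s}"

lemma gr_point_in_concurrence_locus_iff:
  "minors A \<noteq> 0 \<Longrightarrow> gr_point A \<in> concurrence_locus s \<longleftrightarrow> concurrence s (minors A) = 0"
  using form_concurrence[of s]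
    gr_point_in_proj_zeros_iff[of A "{concurrence s}"] gr_point_in_gr_variety[of A]
  by (auto simp: concurrence_locus_def)

lemma closedin_concurrence_locus: "closedin gr_zariski (concurrence_locus s)"
  unfolding concurrence_locus_def using form_concurrence by (intro closedin_gr_zariski_forms) auto

lemma concurrence_locus_eq:
  fixes s :: "nat \<Rightarrow> 'n::finite"
  shows "concurrence_locus s = {gr_point A | A :: complex^3^'n. minors A \<noteq> 0 \<and> concurrence s (minors A) = 0}"
proof (intro subset_antisym subsetI)
  fix L assume L: "L \<in> concurrence_locus s"
  then obtain A :: "complex^3^'n" where A: "L = gr_point A" "minors A \<noteq> 0"
    unfolding concurrence_locus_def gr_variety_eq by blast
  then show "L \<in> {gr_point A | A :: complex^3^'n. minors A \<noteq> 0 \<and> concurrence s (minors A) = 0}"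
    using L gr_point_in_concurrence_locus_iff[OF A(2)] by blast
next
  fix L assume "L \<in> {gr_point A | A :: complex^3^'n. minors A \<noteq> 0 \<and> concurrence s (minors A) = 0}"
  then obtain A :: "complex^3^'n" where A: "L = gr_point A" "minors A \<noteq> 0" "concurrence s (minors A) = 0"
    by blast
  then show "L \<in> concurrence_locus s"
    using gr_point_in_concurrence_locus_iff[OF A(2)] by blast
qed

section \<open>Parametrization of a concurrence locus by an affine space\<close>

lemma det3_zero_common_direction:
  assumes "v \<noteq> 0" "det3 v a b = 0"
  shows "\<exists>u x y x' y'. a = x *s u + y *s v \<and> b = x' *s u + y' *s v"
proof -
  obtain x y z where xyz: "x *s v + y *s a + z *s b = 0" "x \<noteq> 0 \<or> y \<noteq> 0 \<or> z \<noteq> 0"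
    using det3_zero_dependent[OF assms(2)] .
  have *: "x * v $ i + y * a $ i + z * b $ i = 0" for i
    using arg_cong[OF xyz(1), of "\<lambda>w. w $ i"] by simp
  \<comment> \<open>The direction \<open>u\<close> is \<open>a\<close> if the relation can be solved
    for \<open>b\<close>, and otherwise \<open>b\<close>; the third case would give
    \<open>v = 0\<close>. Nothing requires \<open>u\<close> and \<open>v\<close> to be independent,
    so degenerate pairs are covered.\<close>
  consider "z \<noteq> 0" | "z = 0" "y \<noteq> 0" | "z = 0" "y = 0" "x \<noteq> 0"
    using xyz(2) by blast
  then show ?thesis
  proof cases
    case 1
    have "a = 1 *s a + 0 *s v" by simp
    moreover have "b $ i = (- y / z) * a $ i + (- x / z) * v $ i" for i
      using *[of i] 1 by (simp add: field_simps) (metis add.commute add_eq_0_iff2 minus_add_distrib)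
    then have "b = (- y / z) *s a + (- x / z) *s v"
      by (simp add: vec_eq_iff)
    ultimately show ?thesis by blast
  next
    case 2
    have "a $ i = 0 * b $ i + (- x / y) * v $ i" for i
      using *[of i] 2 by (simp add: field_simps add_eq_0_iff)
    then have "a = 0 *s b + (- x / y) *s v"
      by (simp add: vec_eq_iff)
    moreover have "b = 1 *s b + 0 *s v" by simp
    ultimately show ?thesis by blast
  next
    case 3
    then have "v = 0"
      using * by (simp add: vec_eq_iff)
    then show ?thesis
      using assms(1) by simp
  qed
qed

text \<open>The parameters: two scalars for each row, a direction vector for each index, and the
  vector \<open>v\<close> common to all rows.\<close>

datatype 'n coordinate = Multiple 'n | Shift 'n | Direction 'n 3 | Centre 3

text \<open>Makes the two rows of a pair share one direction. A row outside the six represents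
  itself, so it can be chosen freely.\<close>

definition pair_rep :: "(nat \<Rightarrow> 'n) \<Rightarrow> 'n \<Rightarrow> 'n" where
  "pair_rep s = id(s 2 := s 1, s 4 := s 3, s 6 := s 5)"

definition concurrent_matrix :: "(nat \<Rightarrow> 'n::finite) \<Rightarrow> ('n coordinate \<Rightarrow> complex) \<Rightarrow> complex^3^'n" where
  "concurrent_matrix s p = (\<chi> i j. p (Multiple i) * p (Direction (pair_rep s i) j) + p (Shift i) * p (Centre j))"

lemma pair_rep_nth:
  assumes "inj_on s {1..6}"
  shows "pair_rep s (s 1) = s 1" "pair_rep s (s 2) = s 1" "pair_rep s (s 3) = s 3"
    "pair_rep s (s 4) = s 3" "pair_rep s (s 5) = s 5" "pair_rep s (s 6) = s 5"
  using assms by (simp_all add: pair_rep_def inj_on_eq_iff)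

lemma det3_combination:
  "det3 (x *s u + y *s v) (x' *s u + y' *s v) w = (x * y' - x' * y) * det3 u v w"
  unfolding det3_expand vector_add_component vector_smult_component by (simp add: algebra_simps)

text \<open>A minor made of a whole pair and row 5 or 6 sees only the multiple of \<open>u 5\<close>
  in that row. Both products of the quadric are therefore the same expression, symmetric in rows 5
  and 6.\<close>

lemma concurrence_concurrent_matrix:
  assumes "inj_on s {1..6}"
  shows "concurrence s (minors (concurrent_matrix s p)) = 0"
proof -
  define u where "u = (\<lambda>i. \<chi> j. p (Direction (s i) j))"
  define v where "v = (\<chi> j. p (Centre j))"
  have row: "concurrent_matrix s p $ s 1 = p (Multiple (s 1)) *s u 1 + p (Shift (s 1)) *s v"
    "concurrent_matrix s p $ s 2 = p (Multiple (s 2)) *s u 1 + p (Shift (s 2)) *s v"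
    "concurrent_matrix s p $ s 3 = p (Multiple (s 3)) *s u 3 + p (Shift (s 3)) *s v"
    "concurrent_matrix s p $ s 4 = p (Multiple (s 4)) *s u 3 + p (Shift (s 4)) *s v"
    "concurrent_matrix s p $ s 5 = p (Multiple (s 5)) *s u 5 + p (Shift (s 5)) *s v"
    "concurrent_matrix s p $ s 6 = p (Multiple (s 6)) *s u 5 + p (Shift (s 6)) *s v"
    by (simp_all add: vec_eq_iff concurrent_matrix_def pair_rep_nth[OF assms] u_def v_def)
  have *: "det3 (u i) v (x *s u 5 + y *s v) = x * det3 (u i) v (u 5)" for i x y
    by (simp add: det3_expand algebra_simps)
  show ?thesis
    unfolding concurrence_def minors_nth row det3_combination * by (simp add: algebra_simps)
qed

lemma concurrent_matrix_surj:
  fixes A :: "complex^3^'n::finite"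
  assumes s: "inj_on s {1..6}" and A: "concurrence s (minors A) = 0"
  shows "\<exists>p. A = concurrent_matrix s p"
proof -
  \<comment> \<open>The three cross products are dependent, so a nonzero \<open>v\<close> is
    orthogonal to all of them, which means that it is dependent on each pair of rows.\<close>
  obtain v where v: "v \<noteq> 0" "bdot (ccross (A $ s 1) (A $ s 2)) v = 0"
    "bdot (ccross (A $ s 3) (A $ s 4)) v = 0" "bdot (ccross (A $ s 5) (A $ s 6)) v = 0"
    using det3_zero_kernel A unfolding concurrence_minors by blast
  obtain u1 x1 y1 x2 y2 where 1: "A $ s 1 = x1 *s u1 + y1 *s v" "A $ s 2 = x2 *s u1 + y2 *s v"
    using det3_zero_common_direction[OF v(1) v(2)[unfolded bdot_ccross]] by blast
  obtain u3 x3 y3 x4 y4 where 3: "A $ s 3 = x3 *s u3 + y3 *s v" "A $ s 4 = x4 *s u3 + y4 *s v"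
    using det3_zero_common_direction[OF v(1) v(3)[unfolded bdot_ccross]] by blast
  obtain u5 x5 y5 x6 y6 where 5: "A $ s 5 = x5 *s u5 + y5 *s v" "A $ s 6 = x6 *s u5 + y6 *s v"
    using det3_zero_common_direction[OF v(1) v(4)[unfolded bdot_ccross]] by blast
  \<comment> \<open>The defaults 1 and 0, together with the default \<open>A $ i\<close> of
    \<open>u\<close>, reproduce the rows outside the six.\<close>
  define x where "x = (\<lambda>_. 1)(s 1 := x1, s 2 := x2, s 3 := x3, s 4 := x4, s 5 := x5, s 6 := x6)"
  define y where "y = (\<lambda>_. 0)(s 1 := y1, s 2 := y2, s 3 := y3, s 4 := y4, s 5 := y5, s 6 := y6)"
  define u where "u = (\<lambda>i. A $ i)(s 1 := u1, s 3 := u3, s 5 := u5)"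
  have row: "A $ i = x i *s u (pair_rep s i) + y i *s v" for i
  proof (cases "i \<in> {s 1, s 2, s 3, s 4, s 5, s 6}")
    case True
    then show ?thesis
      using s 1 3 5 by (auto simp: pair_rep_nth[OF s] x_def y_def u_def inj_on_eq_iff)
  next
    case False
    then show ?thesis
      by (simp add: pair_rep_def x_def y_def u_def)
  qed
  define p where "p = (\<lambda>c. case c of Multiple i \<Rightarrow> x i | Shift i \<Rightarrow> y i | Direction i j \<Rightarrow> u i $ j | Centre j \<Rightarrow> v $ j)"
  have "A $ i $ j = x i * u (pair_rep s i) $ j + y i * v $ j" for i j
    using arg_cong[OF row[of i], of "\<lambda>w. w $ j"] by simp
  then show ?thesis
    by (intro exI[of _ p]) (simp add: vec_eq_iff concurrent_matrix_def p_def)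
qed

lemma irreducible_concurrence_locus:
  fixes s :: "nat \<Rightarrow> 'n::finite"
  assumes s: "inj_on s {1..6}"
  shows "irreducible_in gr_zariski (concurrence_locus s)"
proof -
  have locus: "concurrence_locus s = {gr_point (concurrent_matrix s p) | p. minors (concurrent_matrix s p) \<noteq> 0}"
    unfolding concurrence_locus_eq
    using concurrent_matrix_surj[OF s] concurrence_concurrent_matrix[OF s] by blast
  \<comment> \<open>A full rank point of the locus: one minor is 1, while the zero rows 2, 4 and 6
    make the quadric vanish.\<close>
  define A :: "complex^3^'n" where
    "A = (\<chi> i. if i = s 1 then axis 1 1 else if i = s 3 then axis 2 1 else if i = s 5 then axis 3 1 else 0)"
  have "minors A $ (s 1, s 3, s 5) = 1"
    using s by (simp add: minors_nth A_def inj_on_eq_iff det3_expand axis_def)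
  then have "minors A \<noteq> 0"
    by auto
  moreover have "concurrence s (minors A) = 0"
    using s by (simp add: concurrence_def minors_nth A_def inj_on_eq_iff det3_expand axis_def)
  ultimately obtain p where "minors (concurrent_matrix s p) \<noteq> 0"
    using concurrent_matrix_surj[OF s] by metis
  moreover have "polyfun (\<lambda>p. concurrent_matrix s p $ i $ j)" for i j
    unfolding concurrent_matrix_def by (simp only: vec_lambda_beta) (intro polyfun_intros)
  ultimately show ?thesis
    unfolding locus by (intro irreducible_in_gr_param)
qed

lemma irreducible_gr_variety:
  assumes "minors (A :: complex^3^'n::finite) \<noteq> 0"
  shows "irreducible_in gr_zariski (gr_variety :: (complex^('n \<times> 'n \<times> 'n)) set set)"
proof -
  define \<Phi> :: "('n \<times> 3 \<Rightarrow> complex) \<Rightarrow> complex^3^'n" where "\<Phi> = (\<lambda>p. \<chi> i j. p (i, j))"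
  have surj: "\<exists>p. B = \<Phi> p" for B
    by (rule exI[of _ "\<lambda>(i, j). B $ i $ j"]) (simp add: \<Phi>_def vec_eq_iff)
  have "gr_variety = {gr_point (\<Phi> p) | p. minors (\<Phi> p) \<noteq> 0}"
    unfolding gr_variety_eq by (intro Collect_cong) (metis surj)
  moreover have "polyfun (\<lambda>p. \<Phi> p $ i $ j)" for i j
    unfolding \<Phi>_def by (simp only: vec_lambda_beta) (intro polyfun_intros)
  ultimately show ?thesis
    using assms surj[of A] irreducible_in_gr_param[of \<Phi>] by metis
qed


subsection \<open>Codimension of a concurrence locus\<close>

definition chart_matrix :: "(nat \<Rightarrow> 'n::finite) \<Rightarrow> ('n \<times> 3 \<Rightarrow> complex) \<Rightarrow> complex^3^'n" where
  "chart_matrix s p = (\<chi> i j. if i = s 1 then axis 1 1 $ j else if i = s 3 then axis 2 1 $ j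
     else if i = s 5 then axis 3 1 $ j else p (i, j))"

lemma polyfun_chart_matrix: "polyfun (\<lambda>p. chart_matrix s p $ i $ j)"
  unfolding chart_matrix_def
  by (cases "i = s 1"; cases "i = s 3"; cases "i = s 5") (simp_all add: polyfun_const polyfun_coord)

lemma chart_matrix_rows:
  assumes "inj_on s {1..6}"
  shows "chart_matrix s p $ s 1 = axis 1 1" "chart_matrix s p $ s 3 = axis 2 1"
    "chart_matrix s p $ s 5 = axis 3 1"
    "chart_matrix s p $ s 2 $ j = p (s 2, j)" "chart_matrix s p $ s 4 $ j = p (s 4, j)"
    "chart_matrix s p $ s 6 $ j = p (s 6, j)"
  using assms by (simp_all add: chart_matrix_def vec_eq_iff inj_on_eq_iff)

lemma det3_axis:
  "det3 (axis 1 1) (axis 2 1) c = c $ 3" "det3 (axis 1 1) b (axis 3 1) = b $ 2"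
  "det3 a (axis 2 1) (axis 3 1) = a $ 1"
  by (simp_all add: det3_expand axis_def)

lemma minors_chart_matrix_nth:
  assumes "inj_on s {1..6}"
  shows "minors (chart_matrix s p) $ (s 1, s 3, s 5) = 1"
  by (simp add: minors_nth chart_matrix_rows[OF assms] det3_axis(1))

lemma minors_chart_matrix_nonzero:
  assumes "inj_on s {1..6}"
  shows "minors (chart_matrix s p) \<noteq> 0"
  using minors_chart_matrix_nth[OF assms, of p] by auto

text \<open>The terms with \<open>p (s 6, 3)\<close> cancel. What remains is linear in
  \<open>p (s 2, 2)\<close>, with a coefficient and a constant term that do not involve this
  coordinate.\<close>

lemma concurrence_chart_matrix:
  assumes "inj_on s {1..6}"
  shows "concurrence s (minors (chart_matrix s p)) =
    p (s 2, 2) * (p (s 4, 3) * p (s 6, 1)) - p (s 2, 3) * p (s 4, 1) * p (s 6, 2)"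
  unfolding concurrence_def minors_nth det3_expand
  by (simp add: chart_matrix_rows[OF assms] axis_def algebra_simps)

text \<open>Multiply on the right by the inverse of the block of rows 1, 3 and 5; the minors change
  only by its determinant.\<close>

lemma chart_matrix_exists:
  fixes A :: "complex^3^'n::finite"
  assumes s: "inj_on s {1..6}" and A: "minors A $ (s 1, s 3, s 5) \<noteq> 0"
  obtains p c where "c \<noteq> 0" "minors (chart_matrix s p) = c *s minors A"
proof -
  let ?M = "vector [A $ s 1, A $ s 3, A $ s 5] :: complex^3^3"
  have "invertible ?M"
    using A by (simp add: invertible_det_nz minors_nth det3_def)
  then obtain C where C: "?M ** C = mat 1"
    unfolding invertible_def by blast
  then have "det ?M * det C = 1"
    by (metis det_I det_mul)
  then have "det C \<noteq> 0"
    by auto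
  define p where "p = (\<lambda>(i, j). (A ** C) $ i $ j)"
  have row: "?M $ k v* C = axis k 1" for k
    using arg_cong[OF C, of "\<lambda>M. M $ k"] by (simp add: matrix_mult_row) (simp add: mat_def axis_def vec_eq_iff)
  have rows: "(A ** C) $ s 1 = axis 1 1" "(A ** C) $ s 3 = axis 2 1" "(A ** C) $ s 5 = axis 3 1"
    using row[of 1] row[of 2] row[of 3] by (simp_all add: matrix_mult_row)
  have "chart_matrix s p $ i $ j = (A ** C) $ i $ j" for i j
    using rows by (simp add: chart_matrix_def p_def)
  then have "chart_matrix s p = A ** C"
    by (simp add: vec_eq_iff)
  then have "minors (chart_matrix s p) = det C *s minors A"
    by (simp only: minors_mult)
  with \<open>det C \<noteq> 0\<close> show ?thesis
    by (rule that)
qed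

text \<open>The entries of \<open>p\<close> at the three fixed rows are dummies; overwriting them
  with the unit vectors gives coordinates that the point of the chart determines.\<close>

definition normalize_chart :: "(nat \<Rightarrow> 'n::finite) \<Rightarrow> ('n \<times> 3 \<Rightarrow> complex) \<Rightarrow> 'n \<times> 3 \<Rightarrow> complex" where
  "normalize_chart s p = (\<lambda>(i, j). chart_matrix s p $ i $ j)"

lemma chart_matrix_normalize_chart: "chart_matrix s (normalize_chart s p) = chart_matrix s p"
  by (simp add: vec_eq_iff chart_matrix_def normalize_chart_def)

lemma normalize_chart_nth:
  assumes "inj_on s {1..6}"
  shows "normalize_chart s p (s 2, j) = p (s 2, j)" "normalize_chart s p (s 4, j) = p (s 4, j)"
    "normalize_chart s p (s 6, j) = p (s 6, j)"
  by (simp_all add: normalize_chart_def chart_matrix_rows[OF assms])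

lemma normalize_chart_update:
  assumes "inj_on s {1..6}"
  shows "normalize_chart s (p((s 2, j) := x)) = (normalize_chart s p)((s 2, j) := x)"
  using assms by (auto simp: normalize_chart_def chart_matrix_def inj_on_eq_iff fun_eq_iff)

text \<open>Inverse of the chart: replacing one of the three unit rows by row \<open>i\<close> gives
  a minor equal to an entry of that row.\<close>

definition chart_coords :: "(nat \<Rightarrow> 'n::finite) \<Rightarrow> ('n \<times> 'n \<times> 'n \<Rightarrow> complex) \<Rightarrow> 'n \<times> 3 \<Rightarrow> complex" where
  "chart_coords s t = (\<lambda>(i, j). if j = 1 then t (i, s 3, s 5) else if j = 2 then t (s 1, i, s 5) else t (s 1, s 3, i))"

lemma polyfun_chart_coords: "polyfun (\<lambda>t. chart_coords s t ij)"
  by (cases "snd ij = 1"; cases "snd ij = 2") (simp_all add: chart_coords_def split_beta polyfun_coord)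

lemma chart_coords_minors:
  assumes "inj_on s {1..6}"
  shows "chart_coords s (($) (minors (chart_matrix s p))) = normalize_chart s p"
proof
  fix ij :: "'a \<times> 3"
  obtain i j where ij: "ij = (i, j)"
    by (cases ij)
  have "j = 1 \<or> j = 2 \<or> j = 3"
    by (rule exhaust_3)
  then show "chart_coords s (($) (minors (chart_matrix s p))) ij = normalize_chart s p ij"
    by (auto simp: ij chart_coords_def normalize_chart_def minors_nth chart_matrix_rows[OF assms] det3_axis)
qed

lemma minors_smult: "minors (\<chi> i j. c * A $ i $ j) = c ^ 3 *s minors A"
  by (simp add: vec_eq_iff split_paired_all minors_nth det3_expand power3_eq_cube algebra_simps)

text \<open>\<open>Y\<close> is covered by the locus and a closed set \<open>D\<close>, given by the
  factor of \<open>F\<close> that remains after powers of the quadric are split off, together with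
  the complement of the chart. Irreducibility puts \<open>Y\<close> into one of the two, and
  \<open>D\<close> is excluded because it does not contain the locus.\<close>

lemma irreducible_closed_between:
  fixes s :: "nat \<Rightarrow> 'n::finite"
  assumes s: "inj_on s {1..6}" and Y: "closedin gr_zariski Y" "irreducible_in gr_zariski Y"
    and sub: "concurrence_locus s \<subseteq> Y" and neq: "Y \<noteq> gr_variety"
  shows "Y \<subseteq> concurrence_locus s"
proof -
  have Ygr: "Y \<subseteq> gr_variety"
    using closedin_subset[OF Y(1)] by (simp add: topspace_gr_zariski)
  obtain S where S: "\<forall>F\<in>S. \<exists>d. form d F"
    "\<And>A. minors A \<noteq> 0 \<Longrightarrow> gr_point A \<in> Y \<longleftrightarrow> (\<forall>F\<in>S. F (minors A) = 0)"
    using closedin_gr_zariski_imp_forms[OF Y(1)] by blast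
  obtain A0 :: "complex^3^'n" where A0: "minors A0 \<noteq> 0" "gr_point A0 \<notin> Y"
    using Ygr neq unfolding gr_variety_eq by blast
  obtain F where F: "F \<in> S" "F (minors A0) \<noteq> 0"
    using S(2) A0 by blast
  obtain d where d: "form d F"
    using S(1) F(1) by blast
  define t0 where "t0 = (s 1, s 3, s 5)"
  define i0 where "i0 = (s 2, 2 :: 3)"
  define b where "b = (\<lambda>p :: 'n \<times> 3 \<Rightarrow> complex. p (s 4, 3) * p (s 6, 1))"
  define r where "r = (\<lambda>p :: 'n \<times> 3 \<Rightarrow> complex. p (s 2, 3) * p (s 4, 1) * p (s 6, 2))"
  define q where "q = (\<lambda>p. p i0 * b p - r p)"
  \<comment> \<open>\<open>\<sigma>\<close> takes the quadric as a new coordinate in place of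
    \<open>i0\<close>. The old coordinate is \<open>(p i0 + r p) / b p\<close> in terms of the new
    one; \<open>M\<close> is this inverse substitution with all entries multiplied by
    \<open>b\<close> to clear the denominator.\<close>
  define \<sigma> where "\<sigma> = (\<lambda>p. p(i0 := q p))"
  define M :: "('n \<times> 3 \<Rightarrow> complex) \<Rightarrow> complex^3^'n" where
    "M = (\<lambda>p. \<chi> i j. if (i, j) = i0 then p i0 + r p else b p * chart_matrix s p $ i $ j)"
  define f where "f = (\<lambda>p. F (minors (chart_matrix s p)))"
  define g where "g = (\<lambda>p. F (minors (M p)))"
  have ne: "s 2 \<noteq> s 4" "s 2 \<noteq> s 6" "s 4 \<noteq> s 2" "s 6 \<noteq> s 2"
    using s by (simp_all add: inj_on_eq_iff)
  have q: "concurrence s (minors (chart_matrix s p)) = q p" for p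
    by (simp add: concurrence_chart_matrix[OF s] q_def i0_def b_def r_def)
  have upd: "b (p(i0 := x)) = b p" "r (p(i0 := x)) = r p" for p x
    using ne by (simp_all add: b_def r_def i0_def)
  have poly_b: "polyfun b" and poly_r: "polyfun r"
    unfolding b_def r_def by (intro polyfun_intros)+
  have poly_q: "polyfun q"
    unfolding q_def by (intro polyfun_intros poly_b poly_r)
  have poly_f: "polyfun f"
    unfolding f_def by (intro polyfun_form[OF d] polyfun_minors polyfun_chart_matrix)
  have poly_M: "polyfun (\<lambda>p. M p $ i $ j)" for i j
  proof (cases "(i, j) = i0")
    case True
    have "polyfun (\<lambda>p. p i0 + r p)"
      by (intro polyfun_intros poly_r)
    then show ?thesis
      using True by (simp add: M_def)
  next
    case False
    have "polyfun (\<lambda>p. b p * chart_matrix s p $ i $ j)"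
      by (intro polyfun_intros poly_b polyfun_chart_matrix)
    then show ?thesis
      using False by (simp add: M_def)
  qed
  have poly_g: "polyfun g"
    unfolding g_def by (intro polyfun_form[OF d] polyfun_minors poly_M)

  have f_scale: "f p = c ^ d * F (minors A)" if "minors (chart_matrix s p) = c *s minors A" for p c A
    unfolding f_def that form_scale[OF d] ..
  \<comment> \<open>\<open>A0\<close> may lie outside the chart, so all matrix entries become free
    parameters: \<open>F\<close> and the minor \<open>t0\<close> are both not identically zero and
    hence nonzero at a common matrix.\<close>
  have "\<exists>p. f p \<noteq> 0"
  proof -
    define \<Psi> :: "('n \<times> 3 \<Rightarrow> complex) \<Rightarrow> complex^3^'n" where "\<Psi> = (\<lambda>p. \<chi> i j. p (i, j))"
    define f' t' where "f' = (\<lambda>p. F (minors (\<Psi> p)))" and "t' = (\<lambda>p. minors (\<Psi> p) $ t0)"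
    have poly: "polyfun (\<lambda>p. \<Psi> p $ i $ j)" for i j
      by (simp add: \<Psi>_def polyfun_coord)
    have "polyfun f'" "polyfun t'"
      unfolding f'_def t'_def by (intro polyfun_form[OF d] polyfun_minors poly)+
    moreover have "\<Psi> (\<lambda>(i, j). A $ i $ j) = A" for A
      by (simp add: \<Psi>_def vec_eq_iff)
    then have "f' (\<lambda>(i, j). A0 $ i $ j) \<noteq> 0" "t' (\<lambda>(i, j). chart_matrix s (\<lambda>_. 0) $ i $ j) \<noteq> 0"
      using F(2) minors_chart_matrix_nth[OF s, of "\<lambda>_. 0"] by (simp_all only: f'_def t'_def t0_def not_False_eq_True zero_neq_one one_neq_zero)
    ultimately obtain p where p: "f' p * t' p \<noteq> 0"
      using polyfun_nonzero_mult[of f' t'] by blast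
    then have "minors (\<Psi> p) $ (s 1, s 3, s 5) \<noteq> 0"
      by (simp add: t'_def t0_def)
    then obtain p' c where "c \<noteq> 0" "minors (chart_matrix s p') = c *s minors (\<Psi> p)"
      by (rule chart_matrix_exists[OF s])
    then have "f p' \<noteq> 0"
      using f_scale p by (simp add: f'_def)
    then show ?thesis by blast
  qed
  then obtain p1 where "f p1 \<noteq> 0" ..
  moreover have "b (\<lambda>_. 1) \<noteq> 0"
    by (simp add: b_def)
  ultimately obtain p2 where p2: "f p2 * b p2 \<noteq> 0"
    using polyfun_nonzero_mult[OF poly_f poly_b] by blast

  have M_sigma: "M (\<sigma> p) = (\<chi> i j. b p * chart_matrix s p $ i $ j)" for p
  proof -
    have "M (\<sigma> p) $ i $ j = b p * chart_matrix s p $ i $ j" for i j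
    proof (cases "(i, j) = i0")
      case True
      then show ?thesis
        using chart_matrix_rows(4)[OF s, of p 2]
        by (simp add: M_def \<sigma>_def upd q_def) (simp add: i0_def)
    next
      case False
      then have "chart_matrix s (\<sigma> p) $ i $ j = chart_matrix s p $ i $ j"
        by (auto simp: chart_matrix_def \<sigma>_def)
      then show ?thesis
        using False by (simp add: M_def) (simp add: \<sigma>_def upd)
    qed
    then show ?thesis
      by (simp add: vec_eq_iff)
  qed
  \<comment> \<open>Minors are cubic in the entries and \<open>F\<close> has degree
    \<open>d\<close>.\<close>
  have g_sigma: "g (\<sigma> p) = (b p ^ 3) ^ d * f p" for p
    unfolding g_def M_sigma minors_smult form_scale[OF d] f_def ..
  then have g: "g (\<sigma> p2) \<noteq> 0"
    using p2 by simp
  \<comment> \<open>At \<open>\<sigma> p\<close> the split-off coordinate is \<open>q p\<close>, so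
    this is the factorization of \<open>f\<close>, up to a power of \<open>b\<close>, into a power
    of the quadric and a rest.\<close>
  obtain k h p3 where poly_h: "polyfun h" and h: "\<And>p. g p = p i0 ^ k * h p" and p3: "h (p3(i0 := 0)) \<noteq> 0"
    using polyfun_factor_variable[of g "\<sigma> p2" i0, OF poly_g g] by blast

  define \<kappa> where "\<kappa> = normalize_chart s"
  have kappa_nth: "\<kappa> p (s 2, j) = p (s 2, j)" "\<kappa> p (s 4, j) = p (s 4, j)" "\<kappa> p (s 6, j) = p (s 6, j)" for p j
    by (simp_all add: \<kappa>_def normalize_chart_nth[OF s])
  have kappa_b: "b (\<kappa> p) = b p" and kappa_r: "r (\<kappa> p) = r p" and kappa_i0: "\<kappa> p i0 = p i0" for p
    by (simp_all add: b_def r_def i0_def kappa_nth)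
  have kappa_g: "g (\<kappa> p) = g p" for p
    unfolding g_def M_def kappa_b kappa_r kappa_i0 unfolding \<kappa>_def chart_matrix_normalize_chart ..
  have kappa_sigma: "\<sigma> (\<kappa> p) = \<kappa> (\<sigma> p)" for p
    unfolding \<sigma>_def q_def kappa_b kappa_r kappa_i0
    unfolding i0_def \<kappa>_def normalize_chart_update[OF s] ..
  have poly_kappa: "polyfun (\<lambda>p. \<kappa> p ij)" for ij
    by (cases ij) (simp add: \<kappa>_def normalize_chart_def polyfun_chart_matrix)
  \<comment> \<open>\<open>h\<close> could depend on the dummy coordinates, but \<open>g\<close>
    does not, and the power of \<open>p i0\<close> can be cancelled: a difference that vanishes
    wherever \<open>p i0\<close> is nonzero vanishes identically.\<close>
  have kappa_h: "h (\<kappa> p) = h p" for p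
  proof (rule ccontr)
    assume "h (\<kappa> p) \<noteq> h p"
    define h' where "h' = (\<lambda>p. h (\<kappa> p) - h p)"
    have "polyfun h'"
      unfolding h'_def by (intro polyfun_diff polyfun_compose[OF poly_h] poly_kappa poly_h)
    moreover have "h' p \<noteq> 0"
      using \<open>h (\<kappa> p) \<noteq> h p\<close> by (simp add: h'_def)
    ultimately obtain p' where p': "h' p' * p' i0 \<noteq> 0"
      using polyfun_nonzero_mult[of h' "\<lambda>p. p i0" p "\<lambda>_. 1"] polyfun_coord[of i0] by auto
    have "p' i0 ^ k * h (\<kappa> p') = p' i0 ^ k * h p'"
      using kappa_g[of p'] unfolding h kappa_i0 .
    then show False
      using p' by (simp add: h'_def)
  qed

  \<comment> \<open>Reads \<open>h\<close> composed with \<open>\<sigma>\<close> as a polynomial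
    function of the minors, to be homogenized to a form on the Pluecker space.\<close>
  define u where "u = (\<lambda>t. h (\<sigma> (chart_coords s t)))"
  have "polyfun (\<lambda>p. h (\<sigma> p))"
    unfolding \<sigma>_def by (rule polyfun_update[OF poly_h poly_q])
  then have "polyfun u"
    unfolding u_def by (rule polyfun_compose) (rule polyfun_chart_coords)
  then obtain e G where G: "form e G" "\<And>x. x $ t0 = 1 \<Longrightarrow> G x = u (($) x)"
    using polyfun_homogenize by blast
  have G_chart: "G (minors (chart_matrix s p)) = h (\<sigma> p)" for p
  proof -
    have "G (minors (chart_matrix s p)) = h (\<sigma> (\<kappa> p))"
      using G(2)[of "minors (chart_matrix s p)"] minors_chart_matrix_nth[OF s, of p]
      by (simp add: t0_def u_def chart_coords_minors[OF s] \<kappa>_def)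
    then show ?thesis
      unfolding kappa_sigma kappa_h .
  qed
  \<comment> \<open>The extra factor puts every point outside the chart into
    \<open>D\<close>.\<close>
  define G' where "G' = (\<lambda>x. x $ t0 * G x)"
  have G': "form (1 + e) G'"
    unfolding G'_def by (rule form_mult[OF form_coord G(1)])
  define D where "D = gr_variety \<inter> proj_zeros wedge3 {G'}"
  have D: "closedin gr_zariski D"
    unfolding D_def using G' by (intro closedin_gr_zariski_forms) blast
  have D_iff: "gr_point A \<in> D \<longleftrightarrow> G' (minors A) = 0" if "minors A \<noteq> 0" for A
    using gr_point_in_proj_zeros_iff[OF that, of "{G'}"] gr_point_in_gr_variety[OF that] G'
    unfolding D_def by blast

  have "Y \<subseteq> concurrence_locus s \<union> D"
  proof
    fix L assume "L \<in> Y"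
    then obtain A :: "complex^3^'n" where A: "L = gr_point A" "minors A \<noteq> 0"
      using Ygr unfolding gr_variety_eq by blast
    show "L \<in> concurrence_locus s \<union> D"
    proof (cases "minors A $ t0 = 0")
      case True
      then show ?thesis
        using D_iff[OF A(2)] A(1) by (simp add: G'_def)
    next
      case False
      then obtain p c where pc: "c \<noteq> 0" "minors (chart_matrix s p) = c *s minors A"
        unfolding t0_def by (rule chart_matrix_exists[OF s])
      have "F (minors A) = 0"
        using S(2)[OF A(2)] \<open>L \<in> Y\<close> A(1) F(1) by blast
      then have "g (\<sigma> p) = 0"
        using f_scale[OF pc(2)] g_sigma by simp
      then have "q p = 0 \<or> h (\<sigma> p) = 0"
        unfolding h by (auto simp: \<sigma>_def)
      then show ?thesis
      proof
        assume "q p = 0"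
        then have "concurrence s (c *s minors A) = 0"
          using q[of p] unfolding pc(2) by simp
        then have "concurrence s (minors A) = 0"
          using pc(1) by (simp add: form_scale[OF form_concurrence])
        then show ?thesis
          using gr_point_in_concurrence_locus_iff[OF A(2)] A(1) by blast
      next
        assume "h (\<sigma> p) = 0"
        then have "G (c *s minors A) = 0"
          using G_chart[of p] unfolding pc(2) by simp
        then have "G (minors A) = 0"
          using pc(1) by (simp add: form_scale[OF G(1)])
        then show ?thesis
          using D_iff[OF A(2)] A(1) by (simp add: G'_def)
      qed
    qed
  qed
  then have "Y \<subseteq> concurrence_locus s \<or> Y \<subseteq> D"
    using Y(2) D closedin_concurrence_locus[of s] unfolding irreducible_in_def by blast
  moreover have "\<not> Y \<subseteq> D"
  proof
    assume "Y \<subseteq> D"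
    define h0 where "h0 = (\<lambda>p. h (p(i0 := 0)))"
    have "polyfun h0"
      unfolding h0_def by (rule polyfun_update[OF poly_h polyfun_const])
    moreover have "h0 p3 \<noteq> 0"
      using p3 by (simp add: h0_def)
    ultimately obtain p4 where p4: "h0 p4 * b p4 \<noteq> 0"
      using polyfun_nonzero_mult[of h0 b p3 "\<lambda>_. 1"] poly_b \<open>b (\<lambda>_. 1) \<noteq> 0\<close> by blast
    \<comment> \<open>Solves \<open>q = 0\<close> for the coordinate \<open>i0\<close>, possible
      since \<open>b p4\<close> is nonzero. This point of the locus is sent by
      \<open>\<sigma>\<close> into the hyperplane where \<open>h\<close> is not identically
      zero.\<close>
    define p5 where "p5 = p4(i0 := r p4 / b p4)"
    have "q p5 = 0"
      using p4 unfolding q_def p5_def upd by simp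
    then have "\<sigma> p5 = p4(i0 := 0)"
      by (simp add: \<sigma>_def p5_def)
    then have "h (\<sigma> p5) \<noteq> 0"
      using p4 by (simp add: h0_def)
    then have "G' (minors (chart_matrix s p5)) \<noteq> 0"
      using minors_chart_matrix_nth[OF s, of p5] by (simp add: G'_def G_chart t0_def)
    moreover have "gr_point (chart_matrix s p5) \<in> concurrence_locus s"
      using gr_point_in_concurrence_locus_iff[OF minors_chart_matrix_nonzero[OF s]] q[of p5] \<open>q p5 = 0\<close> by simp
    ultimately show False
      using sub \<open>Y \<subseteq> D\<close> D_iff[OF minors_chart_matrix_nonzero[OF s]] by blast
  qed
  ultimately show ?thesis by blast
qed

lemma concurrence_not_identically_zero:
  fixes s :: "nat \<Rightarrow> 'n::finite"
  assumes s: "inj_on s {1..6}"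
  shows "\<exists>p. concurrence s (minors (chart_matrix s p)) \<noteq> 0"
proof
  \<comment> \<open>Makes the first monomial of the quadric equal to 1 and the second equal to
    0.\<close>
  let ?p = "\<lambda>ij :: 'n \<times> 3. if ij \<in> {(s 2, 2), (s 4, 3), (s 6, 1)} then 1 else 0 :: complex"
  show "concurrence s (minors (chart_matrix s ?p)) \<noteq> 0"
    using s by (simp add: concurrence_chart_matrix[OF s] inj_on_eq_iff)
qed

lemma concurrence_locus_neq_gr_variety:
  fixes s :: "nat \<Rightarrow> 'n::finite"
  assumes s: "inj_on s {1..6}"
  shows "concurrence_locus s \<noteq> gr_variety"
proof -
  obtain p where "concurrence s (minors (chart_matrix s p)) \<noteq> 0"
    using concurrence_not_identically_zero[OF s] by blast
  then have "gr_point (chart_matrix s p) \<notin> concurrence_locus s"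
    using gr_point_in_concurrence_locus_iff[OF minors_chart_matrix_nonzero[OF s]] by simp
  then show ?thesis
    using gr_point_in_gr_variety[OF minors_chart_matrix_nonzero[OF s]] by blast
qed

text \<open>In a chain of length at least 2 the second member would properly contain the locus and
  hence be the whole Grassmannian, which leaves no room for a third. The chain from the locus to the
  Grassmannian has length 1.\<close>

lemma codimension_concurrence_locus:
  fixes s :: "nat \<Rightarrow> 'n::finite"
  assumes s: "inj_on s {1..6}"
  shows "codimension gr_zariski (concurrence_locus s) = 1"
proof -
  define chain where "chain = (\<lambda>k C. C 0 = concurrence_locus s \<and>
     (\<forall>i\<le>k. closedin gr_zariski (C i) \<and> irreducible_in gr_zariski (C i)) \<and> (\<forall>i<k. C i \<subset> C (Suc i)))"
  have codim: "codimension gr_zariski (concurrence_locus s) = Sup {enat k | k. \<exists>C. chain k C}"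
    unfolding codimension_def chain_def ..
  have gr: "irreducible_in gr_zariski (gr_variety :: (complex^('n \<times> 'n \<times> 'n)) set set)"
    by (rule irreducible_gr_variety[OF minors_chart_matrix_nonzero[OF s]])
  have gr_closed: "closedin gr_zariski (gr_variety :: (complex^('n \<times> 'n \<times> 'n)) set set)"
    using closedin_topspace[of gr_zariski] unfolding topspace_gr_zariski .
  have le: "k \<le> 1" if "chain k C" for k C
  proof (rule ccontr)
    assume "\<not> k \<le> 1"
    then have C: "C 0 = concurrence_locus s" "C 0 \<subset> C 1" "C 1 \<subset> C 2"
      "closedin gr_zariski (C 1)" "irreducible_in gr_zariski (C 1)" "closedin gr_zariski (C 2)"
      using that by (auto simp: chain_def numeral_2_eq_2 One_nat_def)
    have "C 1 = gr_variety"
      using irreducible_closed_between[OF s C(4,5)] C(1,2) by blast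
    moreover have "C 2 \<subseteq> gr_variety"
      using closedin_subset[OF C(6)] unfolding topspace_gr_zariski .
    ultimately show False
      using C(3) by blast
  qed
  have "codimension gr_zariski (concurrence_locus s) \<le> enat 1"
    unfolding codim
  proof (rule Sup_least)
    fix x assume "x \<in> {enat k |k. \<exists>C. chain k C}"
    then obtain k C where "x = enat k" "chain k C"
      by blast
    then show "x \<le> enat 1"
      using le[of k C] by simp
  qed
  moreover have "chain 1 (\<lambda>i. if i = 0 then concurrence_locus s else gr_variety)"
    using concurrence_locus_neq_gr_variety[OF s] gr gr_closed irreducible_concurrence_locus[OF s]
      closedin_concurrence_locus[of s] by (auto simp: chain_def concurrence_locus_def)
  then have "enat 1 \<le> codimension gr_zariski (concurrence_locus s)"
    unfolding codim by (intro Sup_upper) blast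
  ultimately show ?thesis
    by (simp add: one_enat_def)
qed


subsection \<open>Traces at infinity\<close>

text \<open>Identifies affine space with the linear hyperplane whose lines are the points at
  infinity; \<open>finite_part\<close> is the inverse there.\<close>

definition at_infinity :: "complex^3 \<Rightarrow> complex^(3 option)" where
  "at_infinity v = (\<chi> i. case i of None \<Rightarrow> 0 | Some j \<Rightarrow> v $ j)"

definition finite_part :: "complex^(3 option) \<Rightarrow> complex^3" where
  "finite_part x = (\<chi> j. x $ Some j)"

lemma at_infinity_nth [simp]: "at_infinity v $ None = 0" "at_infinity v $ Some j = v $ j"
  by (simp_all add: at_infinity_def)

lemma finite_part_nth [simp]: "finite_part x $ j = x $ Some j"
  by (simp add: finite_part_def)

lemma option3_eq_iff: "x = y \<longleftrightarrow> x $ None = y $ None \<and> finite_part x = finite_part y"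
  for x y :: "complex^(3 option)"
proof
  assume *: "x $ None = y $ None \<and> finite_part x = finite_part y"
  have "x $ i = y $ i" for i
  proof (cases i)
    case (Some j)
    have "finite_part x $ j = finite_part y $ j"
      using * by metis
    then show ?thesis
      using Some by simp
  qed (use * in simp)
  then show "x = y"
    by (simp add: vec_eq_iff)
qed simp

lemma at_infinity_finite_part: "x $ None = 0 \<Longrightarrow> at_infinity (finite_part x) = x"
  by (simp add: option3_eq_iff) (simp add: vec_eq_iff)

lemma finite_part_at_infinity [simp]: "finite_part (at_infinity v) = v"
  by (simp add: vec_eq_iff)

lemma at_infinity_smult: "at_infinity (c *s v) = c *s at_infinity v"
  by (simp add: option3_eq_iff) (simp add: vec_eq_iff)

lemma at_infinity_eq_0_iff: "at_infinity v = 0 \<longleftrightarrow> v = 0"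
  by (simp add: option3_eq_iff) (simp add: vec_eq_iff)

lemma form_linear: "form 1 (\<lambda>x :: complex^'m. \<Sum>i\<in>I. c i * x $ f i)"
proof (induction I rule: infinite_finite_induct)
  case (insert i I)
  then show ?case
    using form_add[OF form_cmult[OF form_coord[of "f i"], of "c i"] insert.IH] by simp
qed (use form_cmult[OF form_coord, of 0] in simp_all)

definition line_at_infinity :: "complex^3 \<Rightarrow> (complex^(3 option)) set" where
  "line_at_infinity a = {x. x $ None = 0 \<and> bdot a (finite_part x) = 0}"

lemma subspace_line_at_infinity: "vec.subspace (line_at_infinity a)"
  by (simp add: vec.subspace_def line_at_infinity_def distrib_left sum.distrib mult.left_commute
      flip: sum_distrib_left)

text \<open>The linear form \<open>l\<close> bounds the closure from above. Conversely, a form that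
  vanishes on the affine points of the plane also vanishes at its points at infinity, by letting the
  homogenizing coordinate become 0.\<close>

lemma trace_at_infinity_eq:
  assumes "normal_to a H"
  shows "trace_at_infinity H = proj_space (line_at_infinity a)"
proof -
  define pt where "pt = (\<lambda>v :: complex^3. \<chi> i. case i of None \<Rightarrow> 1 | Some j \<Rightarrow> v $ j :: complex)"
  have pt_nth: "pt v $ None = 1" "pt v $ Some j = v $ j" for v j
    by (simp_all add: pt_def)
  have H: "v \<in> H \<longleftrightarrow> bdot a v = 0" for v
    using assms by (simp add: normal_to_def)
  define l where "l = (\<lambda>x :: complex^(3 option). \<Sum>j\<in>UNIV. a $ j * x $ Some j)"
  have form_l: "form 1 l"
    unfolding l_def by (rule form_linear)
  have affine_point: "affine_point v \<in> proj_space UNIV" "affine_point v = vec.span {pt v}" for v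
  proof -
    show "affine_point v = vec.span {pt v}"
      by (simp add: affine_point_def pt_def)
    moreover have "pt v \<noteq> 0"
      using pt_nth(1)[of v] by (metis zero_index zero_neq_one)
    ultimately show "affine_point v \<in> proj_space UNIV"
      using span_singleton_in_proj_space[OF _ _ vec.subspace_UNIV] by simp
  qed
  have proj_line: "L \<in> proj_space (line_at_infinity a) \<longleftrightarrow> L \<in> infinity_plane \<and> (\<forall>x\<in>L. l x = 0)" for L
    by (auto simp: proj_space_def infinity_plane_def line_at_infinity_def l_def)
  have closure: "zariski UNIV closure_of (affine_point ` H) \<subseteq> proj_zeros UNIV {l}"
  proof (rule closure_of_minimal)
    show "affine_point ` H \<subseteq> proj_zeros UNIV {l}"
    proof
      fix L assume "L \<in> affine_point ` H"
      then obtain v where v: "v \<in> H" "L = affine_point v"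
        by blast
      have "l (pt v) = 0"
        using v(1) by (simp add: H l_def pt_nth)
      then have "\<forall>x\<in>affine_point v. l x = 0"
        using form_zero_on_span[OF form_l] unfolding affine_point(2) by blast
      then show "L \<in> proj_zeros UNIV {l}"
        using affine_point(1) v(2) by (simp add: proj_zeros_def)
    qed
    show "closedin (zariski UNIV) (proj_zeros UNIV {l})"
      unfolding closedin_zariski using form_l by blast
  qed
  have "L \<in> zariski UNIV closure_of (affine_point ` H)"
    if L: "L \<in> infinity_plane" "\<forall>x\<in>L. l x = 0" for L
  proof -
    obtain x where x: "x \<in> L" "\<And>y. y \<in> L \<Longrightarrow> \<exists>c. y = c *s x"
      using proj_obtains L(1) unfolding infinity_plane_def by blast
    have "x $ None = 0"
      using L(1) x(1) by (auto simp: infinity_plane_def proj_space_def)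
    have "bdot a (finite_part x) = 0"
      using L(2) x(1) by (simp add: l_def)
    have "L \<in> proj_zeros UNIV S" if S: "\<forall>F\<in>S. \<exists>d. form d F" "affine_point ` H \<subseteq> proj_zeros UNIV S" for S
    proof -
      have "F x = 0" if F: "F \<in> S" for F
      proof -
        obtain d where d: "form d F"
          using S(1) F by blast
        have "F (pt v) = 0" if "v \<in> H" for v
          using S(2) F that vec.span_base[of "pt v" "{pt v}"] affine_point(2)[of v]
          unfolding proj_zeros_def by blast
        \<comment> \<open>The points \<open>[t : v]\<close> of the cone, \<open>t \<noteq> 0\<close>, are multiples of affine points; a polynomial
          in \<open>t\<close> vanishing for \<open>t \<noteq> 0\<close> vanishes at \<open>0\<close>.\<close>
        define y where "y = (\<lambda>t :: complex. \<chi> i. case i of None \<Rightarrow> t | Some j \<Rightarrow> x $ Some j)"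
        have "F (y t) = 0" if "t \<noteq> 0" for t
        proof -
          have "inverse t *s finite_part x \<in> H"
            using \<open>bdot a (finite_part x) = 0\<close>
            by (simp add: H mult.left_commute sum_distrib_left[symmetric])
          moreover have "y t = t *s pt (inverse t *s finite_part x)"
            using that by (simp add: option3_eq_iff pt_nth y_def) (simp add: vec_eq_iff pt_nth)
          ultimately show ?thesis
            using \<open>\<And>v. v \<in> H \<Longrightarrow> F (pt v) = 0\<close> form_scale[OF d] by simp
        qed
        moreover have "polyfun (\<lambda>p :: unit \<Rightarrow> complex. y (p ()) $ i)" for i
          by (cases i) (simp_all add: y_def polyfun_const polyfun_coord)
        then have "polyfun (\<lambda>p :: unit \<Rightarrow> complex. F (y (p ())))"
          by (rule polyfun_form[OF d])
        ultimately have "F (y 0) = 0"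
          using polyfun_nonzero_mult[of "\<lambda>p. F (y (p ()))" "\<lambda>p. p ()" "\<lambda>_. 0" "\<lambda>_. 1"] polyfun_coord[of "()"]
          by auto
        moreover have "y 0 = x"
          using \<open>x $ None = 0\<close> by (simp add: option3_eq_iff y_def) (simp add: vec_eq_iff)
        ultimately show ?thesis
          by simp
      qed
      then have "F y = 0" if "F \<in> S" "y \<in> L" for F y
        using x(2)[OF that(2)] S(1) that(1) by (auto simp: form_scale)
      then show ?thesis
        using L(1) by (auto simp: proj_zeros_def proj_space_def infinity_plane_def)
    qed
    moreover obtain S where "\<forall>F\<in>S. \<exists>d. form d F"
      "zariski UNIV closure_of (affine_point ` H) = proj_zeros UNIV S"
      using closedin_closure_of[of "zariski UNIV" "affine_point ` H"] unfolding closedin_zariski by blast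
    moreover have "affine_point ` H \<subseteq> zariski UNIV closure_of (affine_point ` H)"
      using affine_point(1) by (intro closure_of_subset) (auto simp: topspace_zariski)
    ultimately show ?thesis
      by simp
  qed
  then have "L \<in> trace_at_infinity H \<longleftrightarrow> L \<in> proj_space (line_at_infinity a)" for L
    using closure unfolding trace_at_infinity_def proj_line by (auto simp: proj_zeros_def)
  then show ?thesis
    by blast
qed

section \<open>Intersections and collinearity at infinity\<close>

lemma ccross_orthogonal: "bdot a (ccross a b) = 0" "bdot b (ccross a b) = 0"
  by (simp_all add: sum_3 algebra_simps)

lemma ccross_zero_multiple:
  assumes "n \<noteq> 0" "ccross n v = 0"
  shows "\<exists>c. v = c *s n"
proof -
  have "n $ 1 * v $ 2 = n $ 2 * v $ 1" "n $ 2 * v $ 3 = n $ 3 * v $ 2" "n $ 3 * v $ 1 = n $ 1 * v $ 3"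
    using assms(2) by (simp_all add: vec_eq_iff forall_3)
  then have *: "n $ i * v $ j = n $ j * v $ i" for i j
    using exhaust_3[of i] exhaust_3[of j] by auto
  obtain k where k: "n $ k \<noteq> 0"
    using assms(1) by (auto simp: vec_eq_iff)
  define c where "c = v $ k / n $ k"
  have "v $ j = c * n $ j" for j
    using *[of k j] k by (simp add: c_def nonzero_eq_divide_eq mult.commute)
  then have "v = c *s n"
    by (simp add: vec_eq_iff)
  then show ?thesis
    by blast
qed

text \<open>The triple product expansion shows that \<open>v\<close> has zero cross product with
  \<open>ccross a b\<close>.\<close>

lemma orthogonal_multiple_ccross:
  assumes "ccross a b \<noteq> 0" "bdot a v = 0" "bdot b v = 0"
  shows "\<exists>c. v = c *s ccross a b"
proof -
  have "ccross (ccross a b) v = bdot a v *s b - bdot b v *s a"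
    by (simp add: vec_eq_iff forall_3 sum_3 algebra_simps)
  then have "ccross (ccross a b) v = 0"
    using assms(2,3) by simp
  with assms(1) show ?thesis
    by (rule ccross_zero_multiple)
qed

lemma proj_space_Int: "proj_space V \<inter> proj_space W = proj_space (V \<inter> W)"
  by (auto simp: proj_space_def)

lemma proj_space_line:
  assumes "v \<noteq> 0"
  shows "proj_space (vec.span {v}) = {vec.span {v}}"
proof -
  have "L = vec.span {v}" if "L \<in> proj_space (vec.span {v})" for L
    using that assms vec.subspace_dim_equal[of L "vec.span {v}"] by (simp add: proj_space_def)
  then show ?thesis
    using span_singleton_in_proj_space[OF assms, of "vec.span {v}"] by (auto simp: vec.span_base)
qed

lemma line_at_infinity_Int:
  assumes "ccross a b \<noteq> 0"
  shows "line_at_infinity a \<inter> line_at_infinity b = vec.span {at_infinity (ccross a b)}"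
proof (intro subset_antisym subsetI)
  fix x assume x: "x \<in> line_at_infinity a \<inter> line_at_infinity b"
  then obtain c where "finite_part x = c *s ccross a b"
    using orthogonal_multiple_ccross[OF assms, of "finite_part x"] unfolding line_at_infinity_def by blast
  moreover have "x = at_infinity (finite_part x)"
    using x at_infinity_finite_part by (simp add: line_at_infinity_def)
  ultimately have "x = c *s at_infinity (ccross a b)"
    by (simp only: at_infinity_smult)
  then show "x \<in> vec.span {at_infinity (ccross a b)}"
    by (auto simp: vec.span_singleton)
next
  have "at_infinity (ccross a b) \<in> line_at_infinity a" "at_infinity (ccross a b) \<in> line_at_infinity b"
    using ccross_orthogonal[where a = a and b = b] by (simp_all add: line_at_infinity_def del: ccross_nth)
  then show "x \<in> line_at_infinity a \<inter> line_at_infinity b" if "x \<in> vec.span {at_infinity (ccross a b)}" for x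
    using that vec.span_minimal[OF _ subspace_line_at_infinity] by blast
qed

lemma trace_at_infinity_Int:
  assumes "normal_to a H" "normal_to b K" "ccross a b \<noteq> 0"
  shows "trace_at_infinity H \<inter> trace_at_infinity K = {vec.span {at_infinity (ccross a b)}}"
  using assms(3) unfolding trace_at_infinity_eq[OF assms(1)] trace_at_infinity_eq[OF assms(2)]
    proj_space_Int line_at_infinity_Int[OF assms(3)]
  by (intro proj_space_line) (simp only: at_infinity_eq_0_iff not_False_eq_True)

text \<open>If the determinant vanishes, a kernel vector is the normal of a line at infinity through
  all three points, and this line misses the point of some unit vector. Otherwise the three vectors
  span all of affine space.\<close>

lemma proj_span_three_points:
  "proj_span {vec.span {at_infinity u}, vec.span {at_infinity v}, vec.span {at_infinity w}} \<subset> infinity_plane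
    \<longleftrightarrow> det3 u v w = 0"
proof -
  let ?E = "{x :: complex^(3 option). x $ None = 0}"
  let ?P = "vec.span {at_infinity u} \<union> vec.span {at_infinity v} \<union> vec.span {at_infinity w}"
  have E: "vec.subspace ?E"
    by (auto simp: vec.subspace_def)
  have sub: "vec.span ?P \<subseteq> ?E"
    by (intro vec.span_minimal E Un_least) simp_all
  have eq: "proj_span {vec.span {at_infinity u}, vec.span {at_infinity v}, vec.span {at_infinity w}}
      = proj_space (vec.span ?P)"
    by (simp add: proj_span_def Un_assoc)
  have le: "proj_space (vec.span ?P) \<subseteq> infinity_plane"
    unfolding infinity_plane_def proj_space_def using sub by blast
  have "proj_space (vec.span ?P) \<noteq> infinity_plane \<longleftrightarrow> det3 u v w = 0"
  proof
    assume "det3 u v w = 0"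
    then obtain x where x: "x \<noteq> 0" "bdot u x = 0" "bdot v x = 0" "bdot w x = 0"
      by (rule det3_zero_kernel)
    have mem: "at_infinity y \<in> line_at_infinity x" if "bdot y x = 0" for y
      using that by (simp add: line_at_infinity_def mult.commute)
    have "?P \<subseteq> line_at_infinity x"
      by (intro Un_least vec.span_minimal subspace_line_at_infinity) (simp_all add: mem x)
    then have P: "vec.span ?P \<subseteq> line_at_infinity x"
      by (intro vec.span_minimal subspace_line_at_infinity)
    obtain k where k: "x $ k \<noteq> 0"
      using x(1) by (metis vec_eq_iff zero_index)
    have "bdot x (axis k 1) = x $ k"
      by (simp add: axis_def if_distrib cong: if_cong)
    then have "at_infinity (axis k 1) \<notin> vec.span ?P"
      using k P by (auto simp: line_at_infinity_def)
    then have "vec.span {at_infinity (axis k 1)} \<notin> proj_space (vec.span ?P)"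
      using vec.span_base[of "at_infinity (axis k 1)" "{at_infinity (axis k 1)}"]
      unfolding proj_space_def by blast
    moreover have "at_infinity (axis k 1) \<noteq> 0"
      by (simp add: at_infinity_eq_0_iff axis_eq_0_iff)
    then have "vec.span {at_infinity (axis k 1)} \<in> infinity_plane"
      unfolding infinity_plane_def by (intro span_singleton_in_proj_space E) simp_all
    ultimately show "proj_space (vec.span ?P) \<noteq> infinity_plane"
      by blast
  next
    assume neq: "proj_space (vec.span ?P) \<noteq> infinity_plane"
    show "det3 u v w = 0"
    proof (rule ccontr)
      assume "det3 u v w \<noteq> 0"
      let ?M = "transpose (vector [u, v, w]) :: complex^3^3"
      have "invertible ?M"
        using \<open>det3 u v w \<noteq> 0\<close> by (simp add: invertible_det_nz det3_def)
      then obtain N where N: "?M ** N = mat 1"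
        unfolding invertible_def by blast
      have "?E \<subseteq> vec.span ?P"
      proof
        fix x assume "x \<in> ?E"
        define c where "c = N *v finite_part x"
        have "?M *v c = finite_part x"
          by (simp add: c_def matrix_vector_mul_assoc N)
        then have "finite_part x $ i = c $ 1 * u $ i + c $ 2 * v $ i + c $ 3 * w $ i" for i
          by (simp add: vec_eq_iff matrix_vector_mult_def transpose_def sum_3 mult.commute)
        then have "x = c $ 1 *s at_infinity u + c $ 2 *s at_infinity v + c $ 3 *s at_infinity w"
          using \<open>x \<in> ?E\<close> by (simp add: option3_eq_iff) (simp add: vec_eq_iff)
        moreover have "at_infinity u \<in> vec.span ?P" "at_infinity v \<in> vec.span ?P" "at_infinity w \<in> vec.span ?P"
          by (auto intro!: vec.span_base)
        ultimately show "x \<in> vec.span ?P"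
          by (simp only: vec.span_add vec.span_scale)
      qed
      then have "vec.span ?P = ?E"
        using sub by blast
      then show False
        using neq by (simp only: infinity_plane_def)
    qed
  qed
  then show ?thesis
    using le unfolding eq by blast
qed


subsection \<open>Generic arrangements with a dependent sub-arrangement\<close>

lemma generic_arrangement_det3:
  assumes "generic_arrangement H" "\<And>i. normal_to (A i) (H i)" "i \<noteq> j" "i \<noteq> k" "j \<noteq> k"
  shows "det3 (A i) (A j) (A k) \<noteq> 0"
proof
  assume "det3 (A i) (A j) (A k) = 0"
  then obtain x where x: "x \<noteq> 0" "bdot (A i) x = 0" "bdot (A j) x = 0" "bdot (A k) x = 0"
    by (rule det3_zero_kernel)
  then have "x \<in> H i \<inter> H j \<inter> H k"
    using assms(2) by (simp add: normal_to_def)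
  also have "H i \<inter> H j \<inter> H k = {0}"
    using assms(1,3-5) unfolding generic_arrangement_def by blast
  finally show False
    using x(1) by simp
qed

lemma generic_arrangement_minors:
  fixes A :: "complex^3^'n::finite" and s :: "nat \<Rightarrow> 'n"
  assumes "generic_arrangement H" "\<And>i. normal_to (A $ i) (H i)" "inj_on s {1..6}"
  shows "minors A \<noteq> 0"
proof -
  have "det3 (A $ s 1) (A $ s 2) (A $ s 3) \<noteq> 0"
    using assms(3) by (intro generic_arrangement_det3[OF assms(1,2)]) (simp_all add: inj_on_eq_iff)
  then show ?thesis
    by (metis minors_nth zero_index)
qed

lemma generic_arrangement_concurrence:
  fixes A :: "complex^3^'n::finite" and s :: "nat \<Rightarrow> 'n"
  assumes H: "generic_arrangement H" and A: "\<And>i. normal_to (A $ i) (H i)" and s: "inj_on s {1..6}"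
  shows "proj_span ((\<Inter>t\<in>{s 1, s 2}. trace_at_infinity (H t)) \<union> (\<Inter>t\<in>{s 3, s 4}. trace_at_infinity (H t))
      \<union> (\<Inter>t\<in>{s 5, s 6}. trace_at_infinity (H t))) \<subset> infinity_plane
    \<longleftrightarrow> concurrence s (minors A) = 0"
proof -
  \<comment> \<open>Genericity speaks of triples, so a third index \<open>k\<close> is needed to see
    that two normals are not proportional.\<close>
  have cross: "ccross (A $ i) (A $ j) \<noteq> 0" if "k \<noteq> i" "k \<noteq> j" "i \<noteq> j" for i j k
  proof
    assume "ccross (A $ i) (A $ j) = 0"
    then have "det3 (A $ k) (A $ i) (A $ j) = 0"
      by (simp flip: bdot_ccross)
    then show False
      using generic_arrangement_det3[OF H A] that by blast
  qed
  have 1: "(\<Inter>t\<in>{i, j}. trace_at_infinity (H t)) = {vec.span {at_infinity (ccross (A $ i) (A $ j))}}"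
    if "k \<noteq> i" "k \<noteq> j" "i \<noteq> j" for i j k
    using trace_at_infinity_Int[OF A A cross[OF that]] by simp
  have ne: "s 5 \<noteq> s 1" "s 5 \<noteq> s 2" "s 1 \<noteq> s 2" "s 5 \<noteq> s 3" "s 5 \<noteq> s 4" "s 3 \<noteq> s 4"
    "s 1 \<noteq> s 5" "s 1 \<noteq> s 6" "s 5 \<noteq> s 6"
    using s by (simp_all add: inj_on_eq_iff)
  show ?thesis
    unfolding 1[OF ne(1-3)] 1[OF ne(4-6)] 1[OF ne(7-9)] concurrence_minors
      proj_span_three_points[symmetric] by (simp only: Un_insert_left Un_empty_left)
qed

lemma interval_1_6: "{1..6} = {1, 2, 3, 4, 5, 6 :: nat}"
  by auto

lemma has_dependent_subarrangement_iff:
  fixes A :: "complex^3^'n::finite"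
  assumes H: "generic_arrangement H" and A: "\<And>i. normal_to (A $ i) (H i)"
  shows "has_dependent_subarrangement H \<longleftrightarrow> (\<exists>s. inj_on s {1..6} \<and> concurrence s (minors A) = 0)"
proof
  assume "has_dependent_subarrangement H"
  then obtain I1 I2 I3 where I: "I1 \<inter> I2 = {}" "I1 \<inter> I3 = {}" "I2 \<inter> I3 = {}"
    "card I1 = 2" "card I2 = 2" "card I3 = 2"
    "proj_span ((\<Inter>t\<in>I1. trace_at_infinity (H t)) \<union> (\<Inter>t\<in>I2. trace_at_infinity (H t))
      \<union> (\<Inter>t\<in>I3. trace_at_infinity (H t))) \<subset> infinity_plane"
    unfolding has_dependent_subarrangement_def dependent_lines_def by blast
  obtain i1 i2 i3 i4 i5 i6 where i: "I1 = {i1, i2}" "i1 \<noteq> i2" "I2 = {i3, i4}" "i3 \<noteq> i4" "I3 = {i5, i6}" "i5 \<noteq> i6"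
    using I(4-6) by (metis card_2_iff)
  \<comment> \<open>Lists the three pairs in order; the default value \<open>i6\<close> serves as
    \<open>s 6\<close>.\<close>
  define s where "s = (\<lambda>_ :: nat. i6)(1 := i1, 2 := i2, 3 := i3, 4 := i4, 5 := i5 :: 'n)"
  have s_nth: "s 1 = i1" "s 2 = i2" "s 3 = i3" "s 4 = i4" "s 5 = i5" "s 6 = i6"
    by (simp_all add: s_def)
  have s: "inj_on s {1..6}"
    using I(1-3) i unfolding interval_1_6 by (auto simp: s_nth)
  then show "\<exists>s. inj_on s {1..6} \<and> concurrence s (minors A) = 0"
    using generic_arrangement_concurrence[OF H A s] I(7) unfolding s_nth i(1,3,5) by blast
next
  assume "\<exists>s. inj_on s {1..6} \<and> concurrence s (minors A) = 0"
  then obtain s where s: "inj_on s {1..6}" "concurrence s (minors A) = 0"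
    by blast
  have "dependent_lines (s ` {1..6}) (\<lambda>i. trace_at_infinity (H i))"
    unfolding dependent_lines_def
  proof (intro exI conjI)
    show "{s 1, s 2} \<union> {s 3, s 4} \<union> {s 5, s 6} = s ` {1..6}"
      unfolding interval_1_6 by auto
    show "proj_span ((\<Inter>t\<in>{s 1, s 2}. trace_at_infinity (H t)) \<union> (\<Inter>t\<in>{s 3, s 4}. trace_at_infinity (H t))
      \<union> (\<Inter>t\<in>{s 5, s 6}. trace_at_infinity (H t))) \<subset> infinity_plane"
      using generic_arrangement_concurrence[OF H A s(1)] s(2) by blast
  qed (use s(1) in \<open>simp_all add: inj_on_eq_iff\<close>)
  moreover have "card (s ` {1..6}) = 6"
    using s(1) by (simp add: card_image)
  ultimately show "has_dependent_subarrangement H"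
    unfolding has_dependent_subarrangement_def by blast
qed

section \<open>The union of all concurrence loci\<close>

lemma irreducible_in_finite_Union:
  assumes "finite \<F>" "irreducible_in T Z" "\<And>C. C \<in> \<F> \<Longrightarrow> closedin T C" "Z \<subseteq> \<Union>\<F>"
  shows "\<exists>C\<in>\<F>. Z \<subseteq> C"
  using assms(1,3,4)
proof (induction \<F> rule: finite_induct)
  case empty
  then show ?case
    using assms(2) by (simp add: irreducible_in_def)
next
  case (insert C \<F>)
  have "closedin T (\<Union>\<F>)"
    using insert by (intro closedin_Union) auto
  then have "Z \<subseteq> C \<or> Z \<subseteq> \<Union>\<F>"
    using assms(2) insert.prems unfolding irreducible_in_def by simp
  then show ?case
    using insert by blast
qed

lemma concurrence_locus_restrict: "concurrence_locus (restrict s {1..6}) = concurrence_locus s"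
proof -
  have "concurrence (restrict s {1..6}) = concurrence s"
    by (simp add: concurrence_def[abs_def])
  then show ?thesis
    by (simp add: concurrence_locus_def)
qed

text \<open>A locus depends only on the restriction of \<open>s\<close> to six arguments, and there
  are finitely many such restrictions.\<close>

lemma finite_concurrence_loci: "finite (concurrence_locus ` {s :: nat \<Rightarrow> 'n::finite. inj_on s {1..6}})"
proof (rule finite_subset)
  show "concurrence_locus ` {s :: nat \<Rightarrow> 'n. inj_on s {1..6}} \<subseteq> concurrence_locus ` PiE {1..6} (\<lambda>_. UNIV)"
  proof
    fix Z assume "Z \<in> concurrence_locus ` {s :: nat \<Rightarrow> 'n. inj_on s {1..6}}"
    then obtain s :: "nat \<Rightarrow> 'n" where "Z = concurrence_locus s"
      by blast
    then have "Z = concurrence_locus (restrict s {1..6})"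
      by (simp only: concurrence_locus_restrict)
    then show "Z \<in> concurrence_locus ` PiE {1..6} (\<lambda>_. UNIV)"
      by (simp only:) (intro imageI, simp add: restrict_PiE_iff del: restrict_apply)
  qed
  show "finite (concurrence_locus ` PiE {1..6} (\<lambda>_. UNIV :: 'n set))"
    by (intro finite_imageI finite_PiE) auto
qed

theorem theorem5p4:
  assumes "CARD('n::finite) \<ge> 6"
  shows "\<exists>X :: (complex^('n \<times> 'n \<times> 'n)) set set.
           hypersurface gr_zariski X \<and>
           (\<forall>Z. irreducible_component gr_zariski X Z \<longrightarrow>
              (\<exists>Q. quadric wedge3 Q \<and> Z = gr_variety \<inter> Q)) \<and>
           pluecker ` {W. \<exists>H :: 'n \<Rightarrow> (complex^3) set.
               generic_arrangement H \<and> has_dependent_subarrangement H \<and> W \<in> gr_points H} =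
           X \<inter> pluecker ` {W. \<exists>H :: 'n \<Rightarrow> (complex^3) set.
               generic_arrangement H \<and> W \<in> gr_points H}"
proof -
  define \<F> where "\<F> = concurrence_locus ` {s :: nat \<Rightarrow> 'n. inj_on s {1..6}}"
  \<comment> \<open>The bound on the number of planes gives six distinct indices, which make the
    union nonempty and force matrices of normals of generic arrangements to have full rank.\<close>
  obtain s0 :: "nat \<Rightarrow> 'n" where s0: "inj_on s0 {1..6}"
    using card_le_inj[of "{1..6 :: nat}" "UNIV :: 'n set"] assms by auto
  have closed: "closedin gr_zariski C" if "C \<in> \<F>" for C
    using that closedin_concurrence_locus unfolding \<F>_def by blast
  have irreducible: "irreducible_in gr_zariski C" if "C \<in> \<F>" for C
    using that irreducible_concurrence_locus unfolding \<F>_def by blast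
  \<comment> \<open>A component is irreducible, so it lies in one of the finitely many closed loci,
    and by maximality it equals that locus.\<close>
  have component: "Z \<in> \<F>" if Z: "irreducible_component gr_zariski (\<Union>\<F>) Z" for Z
  proof -
    have "finite \<F>"
      unfolding \<F>_def by (rule finite_concurrence_loci)
    then obtain C where C: "C \<in> \<F>" "Z \<subseteq> C"
      using irreducible_in_finite_Union[of \<F> gr_zariski Z] Z closed
      unfolding irreducible_component_def by blast
    then have "C = Z"
      using Z irreducible[OF C(1)] unfolding irreducible_component_def by blast
    then show ?thesis
      using C(1) by simp
  qed
  have "hypersurface gr_zariski (\<Union>\<F>)"
    unfolding hypersurface_def
  proof (intro conjI allI impI)
    show "closedin gr_zariski (\<Union>\<F>)"
      using finite_concurrence_loci closed by (intro closedin_Union) (auto simp: \<F>_def)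
    show "\<Union>\<F> \<noteq> {}"
      using irreducible_concurrence_locus[OF s0] s0 unfolding \<F>_def irreducible_in_def by blast
    show "codimension gr_zariski Z = 1" if "irreducible_component gr_zariski (\<Union>\<F>) Z" for Z
      using component[OF that] codimension_concurrence_locus unfolding \<F>_def by blast
  qed
  moreover have "\<exists>Q. quadric wedge3 Q \<and> Z = gr_variety \<inter> Q"
    if "irreducible_component gr_zariski (\<Union>\<F>) Z" for Z
  proof -
    have "Z \<in> \<F>"
      by (rule component[OF that])
    then obtain s where s: "inj_on s {1..6}" "Z = concurrence_locus s"
      unfolding \<F>_def by blast
    have "quadric wedge3 (proj_zeros wedge3 {concurrence s})"
      unfolding quadric_def
      using form_concurrence[of s] concurrence_not_identically_zero[OF s(1)] minors_in_wedge3 by blast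
    then show ?thesis
      using s(2) unfolding concurrence_locus_def by blast
  qed
  \<comment> \<open>The equivalence holds for every generic \<open>H\<close> and every choice of
    normals, so membership in the union can be tested on whichever representative \<open>W\<close>
    and \<open>H\<close> a point comes with.\<close>
  moreover have "pluecker W \<in> \<Union>\<F> \<longleftrightarrow> has_dependent_subarrangement H"
    if H: "generic_arrangement H" and W: "W \<in> gr_points H" for H :: "'n \<Rightarrow> (complex^3) set" and W
  proof -
    obtain A where A: "W = vec.span (columns A)" "\<And>i. normal_to (A $ i) (H i)"
      using W unfolding gr_points_def by blast
    have minors: "minors A \<noteq> 0"
      by (rule generic_arrangement_minors[OF H A(2) s0])
    have "pluecker W \<in> \<Union>\<F> \<longleftrightarrow> (\<exists>s. inj_on s {1..6} \<and> gr_point A \<in> concurrence_locus s)"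
      unfolding A(1) pluecker_eq[OF minors] \<F>_def by blast
    also have "\<dots> \<longleftrightarrow> has_dependent_subarrangement H"
      unfolding has_dependent_subarrangement_iff[OF H A(2)] gr_point_in_concurrence_locus_iff[OF minors] ..
    finally show ?thesis .
  qed
  then have "pluecker ` {W. \<exists>H :: 'n \<Rightarrow> (complex^3) set.
               generic_arrangement H \<and> has_dependent_subarrangement H \<and> W \<in> gr_points H} =
           \<Union>\<F> \<inter> pluecker ` {W. \<exists>H :: 'n \<Rightarrow> (complex^3) set. generic_arrangement H \<and> W \<in> gr_points H}"
    by blast
  ultimately show ?thesis
    by blast
qed

end
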